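(* Let $a>0$, $b,c\in\mathbb R$, and let $\Pi$ be the parabola $y=\tfrac{a}{2}x^2+bx+c$. (1) Under the affine curve-shortening flow, $\Pi$ moves by vertical translation with constant velocity $a^{1/3}$; thus at time $T>0$ it is the parabola $\Pi^T\colon y=\tfrac a2x^2+bx+c+Ta^{1/3}$. (2) Fix $T>0$. For a positive integer $n$, apply $m=\lfloor c_{\mathrm g}Tn^{4/3}\rfloor$ steps of grid peeling to $\Pi$ with respect to the grid $\tfrac1n\mathbb Z^2$, where $$c_{\mathrm g}=\sqrt[3]{\frac{\pi^2}{2\zeta(3)}}\approx 1.6012.$$ Then, as $n\to\infty$, the vertical distance between the resulting grid polygon and $\Pi^T$ (the supremum over $x\in\mathbb R$ of the absolute difference of their $y$-values at abscissa $x$) is $$O\!\left(\frac{(Ta^{2/3}+a^{-2/3})\log\frac na}{n^{1/3}}\right).$$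
   Context: Affine curve-shortening flow (ACSF): a smooth curve evolves in time so that each point moves in the direction of the normal pointing to the concave side, with normal speed $\kappa^{1/3}$, where $\kappa$ is the current curvature at that point. Grid peeling with respect to a grid $G$ (here $G=\tfrac1n\mathbb Z^2$): one peeling step applied to a set $U\subseteq G$ removes from $U$ all vertices (extreme points) of the convex hull $\mathrm{conv}(U)$. Grid peeling of a convex curve that is the graph of a convex function starts from $U_0=$ the set of points of $G$ on or above the curve and sets $U_{k+1}=U_k\setminus\{\text{vertices of }\mathrm{conv}(U_k)\}$; the grid polygon after $m$ steps is the lower boundary of $\mathrm{conv}(U_m)$, viewed as the graph of a function of $x$. $\zeta$ is the Riemann zeta function. *)

theory Defs
  imports "HOL-Analysis.Analysis"
begin

definition zeta3 :: real where
  "zeta3 = (\<Sum>k. 1 / (real (Suc k)) ^ 3)"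

definition c_g :: real where
  "c_g = root 3 (pi ^ 2 / (2 * zeta3))"

text \<open>Affine curve-shortening flow for a family of graphs y = u t x, t \<ge> 0.
  The upward normal velocity is u_t / sqrt(1+u_x^2); the signed curvature w.r.t. the
  upward normal is u_xx/(1+u_x^2)^(3/2); the curve moves towards its concave side with
  speed |kappa|^(1/3), i.e. signed normal speed = real cube root of kappa.\<close>
definition acsf_graph_flow :: "(real \<Rightarrow> real \<Rightarrow> real) \<Rightarrow> (real \<Rightarrow> real) \<Rightarrow> bool" where
  "acsf_graph_flow u f \<longleftrightarrow> (\<forall>x. u 0 x = f x) \<and>
     (\<forall>t\<ge>0. \<forall>x. \<exists>ut ux uxx.
        ((\<lambda>s. u s x) has_real_derivative ut) (at t within {0..}) \<and>
        (\<forall>y. (\<lambda>z. u t z) differentiable (at y)) \<and>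
        ((\<lambda>y. u t y) has_real_derivative ux) (at x) \<and>
        ((\<lambda>y. deriv (\<lambda>z. u t z) y) has_real_derivative uxx) (at x) \<and>
        ut / sqrt (1 + ux\<^sup>2) = root 3 (uxx / (1 + ux\<^sup>2) powr (3/2)))"

definition grid :: "nat \<Rightarrow> (real \<times> real) set" where
  "grid n = {(of_int i / real n, of_int j / real n) | i j. True}"

definition peel :: "(real \<times> real) set \<Rightarrow> (real \<times> real) set" where
  "peel U = U - {p. p extreme_point_of (convex hull U)}"

definition grid_epi :: "nat \<Rightarrow> (real \<Rightarrow> real) \<Rightarrow> (real \<times> real) set" where
  "grid_epi n f = {p \<in> grid n. snd p \<ge> f (fst p)}"

definition grid_polygon :: "nat \<Rightarrow> (real \<Rightarrow> real) \<Rightarrow> nat \<Rightarrow> real \<Rightarrow> real" where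
  "grid_polygon n f m x = Inf {y. (x, y) \<in> convex hull ((peel ^^ m) (grid_epi n f))}"

end

theory Submission
  imports Defs "HOL-Computational_Algebra.Squarefree" "HOL-Number_Theory.Totient" "HOL-Real_Asymp.Real_Asymp"
begin

text \<open>
  For odd \<open>tau = 2 r + 1\<close> there is a lattice polygon whose peeling can be described exactly. Sort all
  primitive vectors \<open>(i, y)\<close> with \<open>0 < i \<le> tau\<close>, each repeated \<open>tau div i\<close> times, by slope and
  concatenate them; let \<open>V s\<close> be the vertex with tangent slope \<open>s\<close>. Sort the lattice points of the strip
  \<open>\<bar>x\<bar> \<le> r\<close> by their height above the line of slope \<open>s\<close>, and let \<open>w k s\<close> be the \<open>k\<close>-th one. Then the
  polygon with the vertices \<open>V s + w k s\<close> is convex, and peeling it once replaces \<open>k\<close> by \<open>k + 1\<close>; so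
  \<open>tau\<close> peeling steps translate it upwards by 1.

  An increase of the slope by 1 advances \<open>V\<close> horizontally by \<open>H = \<Sum>i\<le>tau. (tau div i) * i * \<phi>(i)\<close>,
  which is \<open>(tau / c_g)^3 + O(tau\<^sup>2 log tau)\<close>. The polygon therefore stays close to a parabola
  of curvature \<open>1 / H\<close>, and it moves at speed \<open>1 / tau\<close>.
  Peeling is monotone. In grid units the given parabola has curvature \<open>a / n\<close>; near any prescribed
  abscissa it is caught between translates of two such polygons, one of slightly larger and one
  of slightly smaller curvature, and so is everything that peeling produces from it.
\<close>

subsection \<open>The Moebius function and divisor sums\<close>

definition moebius_mu :: "nat \<Rightarrow> int" where
  "moebius_mu n = (if squarefree n then (- 1) ^ card (prime_factors n) else 0)"

lemma abs_moebius_mu_le_1: "\<bar>real_of_int (moebius_mu n)\<bar> \<le> 1"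
  by (simp add: moebius_mu_def power_abs)

lemma moebius_mu_prime_mult:
  assumes "prime p" "\<not> p dvd d" "d > 0"
  shows "moebius_mu (p * d) = - moebius_mu d"
proof -
  have "coprime p d" using assms by (simp add: prime_imp_coprime)
  then have "squarefree (p * d) \<longleftrightarrow> squarefree d"
    using assms(1) by (meson squarefree_mult_coprime squarefree_multD(2) squarefree_prime)
  moreover have "prime_factors (p * d) = insert p (prime_factors d)"
    using assms by (simp add: prime_factors_product prime_prime_factors prime_gt_0_nat)
  moreover have "p \<notin> prime_factors d" using assms by auto
  ultimately show ?thesis by (simp add: moebius_mu_def)
qed

lemma moebius_mu_square_dvd:
  assumes "prime p" "p\<^sup>2 dvd d"
  shows "moebius_mu d = 0"
proof -
  have "\<not> is_unit p" using assms(1) not_prime_unit by blast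
  then have "\<not> squarefree d" using assms(2) not_squarefreeI by blast
  then show ?thesis by (simp add: moebius_mu_def)
qed

lemma sum_divisors_split_prime:
  fixes f :: "nat \<Rightarrow> 'a::comm_monoid_add"
  assumes "n > 0" "prime p" "p dvd n" and square: "\<And>d. p\<^sup>2 dvd d \<Longrightarrow> f d = 0"
  shows "(\<Sum>d | d dvd n. f d) = (\<Sum>d | d dvd n \<and> \<not> p dvd d. f d + f (p * d))"
proof -
  let ?A = "{d. d dvd n \<and> \<not> p dvd d}" and ?B = "{d. d dvd n \<and> p dvd d}"
  have fin: "finite {d. d dvd n}" using assms by simp
  have p_pos: "p > 0" using assms(2) prime_gt_0_nat by blast
  have "(\<Sum>d\<in>?B. f d) = (\<Sum>d\<in>?A. f (p * d))"
  proof (rule sum.mono_neutral_cong_right[of ?B "(*) p ` ?A", THEN trans])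
    show "finite ?B" by (rule finite_subset[OF _ fin]) auto
    show "(*) p ` ?A \<subseteq> ?B"
      using assms(2,3) by (auto intro!: divides_mult prime_imp_coprime)
    show "\<forall>d\<in>?B - (*) p ` ?A. f d = 0"
    proof
      fix d assume d_uncovered: "d \<in> ?B - (*) p ` ?A"
      then obtain e where d_eq: "d = p * e" by auto
      then have "p dvd e" using d_uncovered by (auto dest: dvd_mult_right)
      then show "f d = 0" using d_eq by (intro square) (auto simp: power2_eq_square)
    qed
    show "(\<Sum>d\<in>(*) p ` ?A. f d) = (\<Sum>d\<in>?A. f (p * d))"
      using p_pos by (subst sum.reindex) (auto simp: inj_on_def)
  qed simp
  moreover have "(\<Sum>d | d dvd n. f d) = (\<Sum>d\<in>?A. f d) + (\<Sum>d\<in>?B. f d)"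
    by (subst sum.union_disjoint[symmetric])
       (auto intro!: sum.cong intro: finite_subset[OF _ fin])
  ultimately show ?thesis by (simp add: sum.distrib)
qed

lemma sum_moebius_mu_divisors:
  assumes "n > 0"
  shows "(\<Sum>d | d dvd n. moebius_mu d) = of_bool (n = 1)"
proof (cases "n = 1")
  case False
  then obtain p where p_prime: "prime p" "p dvd n" by (metis prime_factor_nat)
  have "(\<Sum>d | d dvd n. moebius_mu d)
      = (\<Sum>d | d dvd n \<and> \<not> p dvd d. moebius_mu d + moebius_mu (p * d))"
    using assms p_prime by (intro sum_divisors_split_prime moebius_mu_square_dvd)
  also have "\<dots> = 0"
    using assms p_prime(1) by (intro sum.neutral) (auto simp: moebius_mu_prime_mult dvd_pos_nat)
  finally show ?thesis using False by simp
qed (simp add: moebius_mu_def)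

lemma sum_moebius_mu_common_divisors:
  assumes "i > 0"
  shows "(\<Sum>e | e dvd i \<and> int e dvd y. moebius_mu e) = of_bool (coprime y (int i))"
proof -
  define g where "g = nat (gcd y (int i))"
  have g_gcd: "int g = gcd y (int i)" by (simp add: g_def)
  have "e dvd i \<and> int e dvd y \<longleftrightarrow> e dvd g" for e
    by (metis g_gcd gcd_greatest_iff int_dvd_int_iff)
  moreover have "g > 0" using assms by (simp add: g_def)
  moreover have "g = 1 \<longleftrightarrow> coprime y (int i)" by (simp add: g_def nat_eq_iff coprime_iff_gcd_eq_1)
  ultimately show ?thesis using sum_moebius_mu_divisors[of g] by simp
qed

lemma sum_sum_divisors:
  fixes F :: "nat \<Rightarrow> nat \<Rightarrow> 'a::comm_monoid_add"
  shows "(\<Sum>i=1..t. \<Sum>e | e dvd i. F e (i div e)) = (\<Sum>e=1..t. \<Sum>f=1..t div e. F e f)"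
proof -
  have "(\<Sum>i=1..t. \<Sum>e | e dvd i. F e (i div e)) = (\<Sum>i=1..t. \<Sum>e | e \<in> {1..t} \<and> e dvd i. F e (i div e))"
  proof (intro sum.cong refl)
    fix i assume "i \<in> {1..t}"
    then show "{e. e dvd i} = {e. e \<in> {1..t} \<and> e dvd i}"
      by (auto intro: Nat.gr0I dest: dvd_imp_le simp: Suc_le_eq)
  qed
  also have "\<dots> = (\<Sum>e=1..t. \<Sum>i | i \<in> {1..t} \<and> e dvd i. F e (i div e))"
    by (rule sum.swap_restrict) auto
  also have "\<dots> = (\<Sum>e=1..t. \<Sum>f=1..t div e. F e f)"
  proof (rule sum.cong[OF refl])
    fix e assume e_range: "e \<in> {1..t}"
    show "(\<Sum>i | i \<in> {1..t} \<and> e dvd i. F e (i div e)) = (\<Sum>f=1..t div e. F e f)"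
      by (rule sum.reindex_bij_witness[of _ "\<lambda>f. e * f" "\<lambda>i. i div e"])
         (use e_range in \<open>auto simp: less_eq_div_iff_mult_less_eq mult.commute Suc_le_eq div_le_mono
            dvd_imp_le\<close>)
  qed
  finally show ?thesis .
qed

lemma sum_div_mult:
  fixes g :: "nat \<Rightarrow> 'a::comm_semiring_1"
  shows "(\<Sum>f=1..m. of_nat (m div f) * g f) = (\<Sum>k=1..m. \<Sum>f=1..m div k. g f)"
proof -
  have "(\<Sum>f=1..m. of_nat (m div f) * g f) = (\<Sum>f=1..m. \<Sum>k=1..m div f. g f)" by simp
  also have "\<dots> = (\<Sum>i=1..m. \<Sum>f | f dvd i. g f)" by (rule sum_sum_divisors[symmetric])
  also have "\<dots> = (\<Sum>i=1..m. \<Sum>k | k dvd i. g (i div k))"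
  proof (rule sum.cong[OF refl])
    fix i assume "i \<in> {1..m}"
    then show "(\<Sum>f | f dvd i. g f) = (\<Sum>k | k dvd i. g (i div k))"
      by (intro sum.reindex_bij_witness[of _ "\<lambda>k. i div k" "\<lambda>k. i div k"]) auto
  qed
  also have "\<dots> = (\<Sum>k=1..m. \<Sum>f=1..m div k. g f)" by (rule sum_sum_divisors)
  finally show ?thesis .
qed

lemma sum_moebius_mu_completely_multiplicative:
  fixes g :: "nat \<Rightarrow> 'a::comm_ring_1"
  assumes "\<And>e f. g (e * f) = g e * g f" "g 1 = 1" "t > 0"
  shows "(\<Sum>e=1..t. of_int (moebius_mu e) * g e * (\<Sum>f=1..t div e. g f)) = 1"
proof -
  have "(\<Sum>e=1..t. of_int (moebius_mu e) * g e * (\<Sum>f=1..t div e. g f))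
      = (\<Sum>e=1..t. \<Sum>f=1..t div e. of_int (moebius_mu e) * g (e * f))"
    by (simp add: sum_distrib_left assms(1) mult.assoc)
  also have "\<dots> = (\<Sum>i=1..t. \<Sum>e | e dvd i. of_int (moebius_mu e) * g (e * (i div e)))"
    by (rule sum_sum_divisors[symmetric])
  also have "\<dots> = (\<Sum>i=1..t. of_int (\<Sum>e | e dvd i. moebius_mu e) * g i)"
    by (intro sum.cong refl) (simp add: sum_distrib_right)
  also have "\<dots> = (\<Sum>i=1..t. of_bool (i = 1) * g i)"
    by (intro sum.cong refl) (simp add: sum_moebius_mu_divisors)
  also have "\<dots> = (\<Sum>i=1..t. if i = 1 then g i else 0)" by (intro sum.cong) auto
  also have "\<dots> = 1" using assms(2,3) by simp
  finally show ?thesis .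
qed

subsection \<open>Counting coprime integers\<close>

definition signed_sum :: "(int \<Rightarrow> 'a::ab_group_add) \<Rightarrow> int \<Rightarrow> 'a" where
  "signed_sum f m = (\<Sum>y\<in>{0<..m}. f y) - (\<Sum>y\<in>{m<..0}. f y)"

lemma signed_sum_diff:
  assumes "a \<le> b"
  shows "signed_sum f b - signed_sum f a = (\<Sum>y\<in>{a<..b}. f y)"
proof -
  have union: "sum f {l<..m} + sum f {m<..u} = sum f {l<..u}" if "l \<le> m" "m \<le> u" for l m u
    using that sum.union_disjoint[of "{l<..m}" "{m<..u}" f] by (simp add: ivl_disj_un)
  consider "0 \<le> a" | "a < 0" "0 \<le> b" | "b < 0" by linarith
  then show ?thesis
  proof cases
    case nonneg: 1
    then show ?thesis using assms by (simp add: signed_sum_def flip: union[of 0 a b])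
  next
    case mixed: 2
    then show ?thesis by (simp add: signed_sum_def flip: union[of a 0 b])
  next
    case negative: 3
    then show ?thesis using assms by (simp add: signed_sum_def flip: union[of a b 0])
  qed
qed

lemma signed_sum_unique:
  assumes "F 0 = 0" "\<And>m. F m - F (m - 1) = f m"
  shows "signed_sum f m = F m"
proof -
  have step: "signed_sum f m - signed_sum f (m - 1) = f m" for m
  proof -
    have "{m - 1<..m} = {m}" by auto
    then show ?thesis using signed_sum_diff[of "m - 1" m f] by simp
  qed
  show ?thesis
  proof (induction m rule: int_induct[where k = 0])
    case base
    then show ?case using assms(1) by (simp add: signed_sum_def)
  next
    case (step1 i)
    then show ?case using step[of "i + 1"] assms(2)[of "i + 1"] by (simp add: algebra_simps)
  next
    case (step2 i)
    then show ?case using step[of i] assms(2)[of i] by (simp add: algebra_simps)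
  qed
qed

lemma signed_sum_cmult:
  fixes c :: "'a::ring"
  shows "signed_sum (\<lambda>y. c * f y) m = c * signed_sum f m"
  unfolding signed_sum_def sum_distrib_left[symmetric] right_diff_distrib ..

lemma div_minus_div_pred:
  fixes d m :: int
  assumes "d > 0"
  shows "m div d - (m - 1) div d = of_bool (d dvd m)"
proof (cases "d dvd m")
  case True
  then obtain k where m_eq: "m = d * k" ..
  have "(m - 1) div d = k - 1"
    using assms by (intro int_div_pos_eq[where r = "d - 1"]) (auto simp: m_eq algebra_simps)
  then show ?thesis using assms m_eq by simp
next
  case False
  then have "0 < m mod d" "m mod d < d"
    using assms pos_mod_sign[of d m] pos_mod_bound[of d m]
    by (auto simp: dvd_eq_mod_eq_0 order_less_le)
  then have "(m - 1) div d = m div d"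
    by (intro int_div_pos_eq[where r = "m mod d - 1"]) (auto simp: algebra_simps)
  then show ?thesis using False by simp
qed

definition coprime_count :: "nat \<Rightarrow> int \<Rightarrow> int" where
  "coprime_count i = signed_sum (\<lambda>y. of_bool (coprime y (int i)))"

lemma coprime_count_eq_sum_moebius_mu:
  assumes "i > 0"
  shows "coprime_count i m = (\<Sum>e | e dvd i. moebius_mu e * (m div int e))"
  unfolding coprime_count_def
proof (rule signed_sum_unique)
  fix m :: int
  let ?F = "\<lambda>m. \<Sum>e | e dvd i. moebius_mu e * (m div int e)"
  have "?F m - ?F (m - 1) = (\<Sum>e | e dvd i. if int e dvd m then moebius_mu e else 0)"
    unfolding sum_subtractf[symmetric] right_diff_distrib[symmetric]
    using assms by (intro sum.cong refl) (auto simp: div_minus_div_pred dvd_pos_nat)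
  also have "\<dots> = (\<Sum>e | e dvd i \<and> int e dvd m. moebius_mu e)"
    using assms by (subst sum.inter_filter[symmetric]) auto
  also have "\<dots> = of_bool (coprime m (int i))" by (rule sum_moebius_mu_common_divisors[OF assms])
  finally show "?F m - ?F (m - 1) = of_bool (coprime m (int i))" .
qed simp

lemma totient_eq_sum_moebius_mu:
  assumes "i > 0"
  shows "real (totient i) = (\<Sum>e | e dvd i. of_int (moebius_mu e) * real (i div e))"
proof -
  have "int (totient i) = (\<Sum>y\<in>{0<..i}. of_bool (coprime y i))"
    by (simp add: totient_def totatives_def sum.If_cases of_bool_def Int_def)
  also have "\<dots> = (\<Sum>y\<in>{0<..int i}. of_bool (coprime y (int i)))"
    by (rule sum.reindex_bij_witness[of _ nat int]) auto
  also have "\<dots> = coprime_count i (int i)" by (simp add: coprime_count_def signed_sum_def)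
  also have "\<dots> = (\<Sum>e | e dvd i. moebius_mu e * int (i div e))"
    unfolding coprime_count_eq_sum_moebius_mu[OF assms] by (simp add: zdiv_int)
  finally have "real_of_int (int (totient i)) = real_of_int (\<Sum>e | e dvd i. moebius_mu e * int (i div e))"
    by (rule arg_cong)
  then show ?thesis by simp
qed

lemma coprime_count_approx:
  fixes s :: real
  assumes "i > 0"
  shows "\<bar>real_of_int (coprime_count i \<lfloor>s * real i\<rfloor>) - s * real (totient i)\<bar> \<le> real (card {e. e dvd i})"
proof -
  let ?r = "\<lambda>e. real_of_int (\<lfloor>s * real i\<rfloor> div int e) - s * real (i div e)"
  have "real_of_int (coprime_count i \<lfloor>s * real i\<rfloor>) - s * real (totient i)
      = (\<Sum>e | e dvd i. of_int (moebius_mu e) * ?r e)"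
    unfolding coprime_count_eq_sum_moebius_mu[OF assms] totient_eq_sum_moebius_mu[OF assms] sum_distrib_left
    by (simp add: sum_subtractf right_diff_distrib ac_simps)
  also have "\<bar>\<dots>\<bar> \<le> (\<Sum>e | e dvd i. \<bar>of_int (moebius_mu e) * ?r e\<bar>)" by (rule sum_abs)
  also have "\<dots> \<le> (\<Sum>e | e dvd i. 1)"
  proof (rule sum_mono)
    fix e assume "e \<in> {e. e dvd i}"
    then have "real (i div e) = real i / real e" by (simp add: real_of_nat_div)
    then have "\<lfloor>s * real i\<rfloor> div int e = \<lfloor>s * real (i div e)\<rfloor>"
      using floor_divide_real_eq_div[of "int e" "s * real i"] by simp
    then have "\<bar>?r e\<bar> \<le> 1" by linarith
    then show "\<bar>of_int (moebius_mu e) * ?r e\<bar> \<le> 1"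
      unfolding abs_mult using abs_moebius_mu_le_1 by (intro mult_le_one) auto
  qed
  finally show ?thesis by simp
qed

subsection \<open>The horizontal period\<close>

lemma sum_squares_approx:
  fixes y :: real
  assumes "1 \<le> y"
  shows "\<bar>(\<Sum>f=1..nat \<lfloor>y\<rfloor>. real f ^ 2) - y ^ 3 / 3\<bar> \<le> y ^ 2"
proof -
  define n where "n = nat \<lfloor>y\<rfloor>"
  have n_floor: "real n \<le> y" "y < real n + 1" "1 \<le> real n" using assms by (auto simp: n_def)
  have pyramid: "(\<Sum>f=1..n. real f ^ 2) = real n ^ 3 / 3 + real n ^ 2 / 2 + real n / 6"
    by (induction n) (simp_all add: power2_eq_square power3_eq_cube field_simps)
  have cube_le: "real n ^ 3 \<le> y ^ 3" and square_le: "real n ^ 2 \<le> y ^ 2"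
    using n_floor by (auto intro: power_mono)
  have "real n \<le> y ^ 2"
    using n_floor assms mult_mono[of 1 y "real n" y] by (simp add: power2_eq_square)
  moreover have "y ^ 3 - real n ^ 3 \<le> 3 * y ^ 2"
  proof -
    have "y ^ 3 - real n ^ 3 = (y - real n) * (y ^ 2 + y * real n + real n ^ 2)"
      by (simp add: power2_eq_square power3_eq_cube algebra_simps)
    also have "\<dots> \<le> 1 * (y ^ 2 + y * real n + real n ^ 2)"
      using n_floor assms by (intro mult_right_mono) auto
    also have "y * real n \<le> y ^ 2" using n_floor assms by (simp add: power2_eq_square)
    finally show ?thesis using square_le by simp
  qed
  moreover have "0 \<le> real n ^ 2" by simp
  ultimately show ?thesis
    using n_floor(3) cube_le square_le unfolding n_def[symmetric] pyramid by linarith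
qed

lemma zeta_partial_sum_bounds:
  fixes p m :: nat
  assumes p_ge: "2 \<le> p" and sums: "(\<lambda>k. 1 / real (Suc k) ^ p) sums z"
  shows "(\<Sum>k=1..m. 1 / real k ^ p) \<le> z"
    and "0 < m \<Longrightarrow> z - (\<Sum>k=1..m. 1 / real k ^ p) \<le> 1 / real m"
proof -
  have shift: "(\<Sum>k=1..m. 1 / real k ^ p) = (\<Sum>k<m. 1 / real (Suc k) ^ p)"
    by (rule sum.reindex_bij_witness[of _ Suc "\<lambda>k. k - 1"]) auto
  show "(\<Sum>k=1..m. 1 / real k ^ p) \<le> z"
    unfolding shift sums_unique[OF sums] using sums by (intro sum_le_suminf sums_summable) auto
  assume m_pos: "0 < m"
  have tail: "(\<lambda>k. 1 / real (Suc (k + m)) ^ p) sums (z - (\<Sum>k<m. 1 / real (Suc k) ^ p))"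
    using sums by (rule sums_split_initial_segment)
  have telescope: "(\<lambda>k. 1 / real (k + m) - 1 / real (Suc k + m)) sums (1 / real (0 + m) - 0)"
    by (rule telescope_sums') (rule LIMSEQ_ignore_initial_segment[OF lim_1_over_n])
  have "z - (\<Sum>k<m. 1 / real (Suc k) ^ p) \<le> 1 / real (0 + m) - 0"
  proof (rule sums_le[OF _ tail telescope])
    fix k
    have "real (k + m) * real (Suc k + m) \<le> real (Suc (k + m)) ^ 2"
      by (simp add: power2_eq_square)
    also have "\<dots> \<le> real (Suc (k + m)) ^ p" using p_ge by (intro power_increasing) auto
    finally have "1 / real (Suc (k + m)) ^ p \<le> 1 / (real (k + m) * real (Suc k + m))"
      using m_pos by (intro divide_left_mono) auto
    also have "\<dots> = 1 / real (k + m) - 1 / real (Suc k + m)" using m_pos by (simp add: field_simps)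
    finally show "1 / real (Suc (k + m)) ^ p \<le> 1 / real (k + m) - 1 / real (Suc k + m)" .
  qed
  then show "z - (\<Sum>k=1..m. 1 / real k ^ p) \<le> 1 / real m" unfolding shift by simp
qed

lemma zeta2_sums: "(\<lambda>k. 1 / real (Suc k) ^ 2) sums (pi ^ 2 / 6)"
  using inverse_squares_sums by (simp add: add.commute)

lemma zeta3_sums: "(\<lambda>k. 1 / real (Suc k) ^ 3) sums zeta3"
proof -
  have "summable (\<lambda>k. 1 / real (Suc k) ^ 3)"
  proof (rule summable_comparison_test'[OF sums_summable[OF zeta2_sums]])
    show "norm (1 / real (Suc k) ^ 3) \<le> 1 / real (Suc k) ^ 2" for k
      by (simp add: divide_left_mono power_increasing)
  qed
  then show ?thesis unfolding zeta3_def by (rule summable_sums)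
qed

lemmas zeta2_partial_sum_bounds = zeta_partial_sum_bounds[OF order_refl zeta2_sums]

lemma zeta3_partial_sum_bounds:
  shows "(\<Sum>k=1..m. 1 / real k ^ 3) \<le> zeta3"
    and "0 < m \<Longrightarrow> zeta3 - (\<Sum>k=1..m. 1 / real k ^ 3) \<le> 1 / real m"
  using zeta_partial_sum_bounds[OF _ zeta3_sums] by simp_all

lemma zeta3_ge_1: "1 \<le> zeta3" and zeta3_le_2: "zeta3 \<le> 2"
  using zeta3_partial_sum_bounds[of 1] by simp_all

definition divisor_square_sum :: "nat \<Rightarrow> real" where
  "divisor_square_sum m = (\<Sum>k=1..m. \<Sum>f=1..m div k. real f ^ 2)"

lemma divisor_square_sum_approx_partial:
  fixes y :: real
  assumes "1 \<le> y"
  shows "\<bar>divisor_square_sum (nat \<lfloor>y\<rfloor>) - y ^ 3 / 3 * (\<Sum>k=1..nat \<lfloor>y\<rfloor>. 1 / real k ^ 3)\<bar> \<le> 2 * y ^ 2"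
proof -
  define m where "m = nat \<lfloor>y\<rfloor>"
  have m_le: "real m \<le> y" using assms by (simp add: m_def)
  let ?r = "\<lambda>k. (\<Sum>f=1..m div k. real f ^ 2) - (y / k) ^ 3 / 3"
  have "divisor_square_sum m - y ^ 3 / 3 * (\<Sum>k=1..m. 1 / real k ^ 3) = (\<Sum>k=1..m. ?r k)"
    by (simp add: divisor_square_sum_def sum_subtractf sum_distrib_left power_divide mult.commute)
  also have "\<bar>\<dots>\<bar> \<le> (\<Sum>k=1..m. \<bar>?r k\<bar>)" by (rule sum_abs)
  also have "\<dots> \<le> (\<Sum>k=1..m. (y / k) ^ 2)"
  proof (rule sum_mono)
    fix k assume k_range: "k \<in> {1..m}"
    then have "real k \<le> real m" by simp
    then have "1 \<le> y / k" using k_range m_le by simp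
    moreover have "m div k = nat \<lfloor>y / k\<rfloor>"
      using floor_divide_real_eq_div[of "int k" y] assms by (simp add: m_def nat_div_distrib)
    ultimately show "\<bar>?r k\<bar> \<le> (y / k) ^ 2" using sum_squares_approx by simp
  qed
  also have "\<dots> = y ^ 2 * (\<Sum>k=1..m. 1 / real k ^ 2)" by (simp add: sum_distrib_left power_divide)
  also have "\<dots> \<le> y ^ 2 * 2"
  proof (rule mult_left_mono)
    have "pi ^ 2 / 6 \<le> 2" using zeta2_partial_sum_bounds(2)[of 1] by simp
    then show "(\<Sum>k=1..m. 1 / real k ^ 2) \<le> 2" using zeta2_partial_sum_bounds(1)[of m] by linarith
  qed simp
  finally show ?thesis by (simp add: m_def mult.commute)
qed

lemma divisor_square_sum_approx:
  fixes y :: real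
  assumes "1 \<le> y"
  shows "\<bar>divisor_square_sum (nat \<lfloor>y\<rfloor>) - zeta3 * y ^ 3 / 3\<bar> \<le> 3 * y ^ 2"
proof -
  define m where "m = nat \<lfloor>y\<rfloor>"
  have m_floor: "y < real m + 1" "1 \<le> real m" using assms by (auto simp: m_def)
  let ?Z = "\<Sum>k=1..m. 1 / real k ^ 3"
  have "y \<le> 2 * real m" using m_floor by linarith
  then have "2 / (2 * real m) \<le> 2 / y" using assms by (intro divide_left_mono) auto
  then have tail: "0 \<le> zeta3 - ?Z" "zeta3 - ?Z \<le> 2 / y"
    using zeta3_partial_sum_bounds[of m] m_floor by auto
  have "0 \<le> y ^ 3 / 3 * (zeta3 - ?Z)" using tail assms by simp
  moreover have "y ^ 3 / 3 * (zeta3 - ?Z) \<le> y ^ 3 / 3 * (2 / y)"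
    using tail assms by (intro mult_left_mono) auto
  moreover have "y ^ 3 / 3 * (2 / y) \<le> y ^ 2"
    using assms by (simp add: power3_eq_cube power2_eq_square)
  moreover have "zeta3 * y ^ 3 / 3 = y ^ 3 / 3 * ?Z + y ^ 3 / 3 * (zeta3 - ?Z)"
    by (simp add: algebra_simps)
  ultimately show ?thesis
    using divisor_square_sum_approx_partial[OF assms] unfolding m_def[symmetric] by linarith
qed

lemma harm_le_ln: "t > 0 \<Longrightarrow> harm t \<le> 1 + ln (real t)"
  using decseqD[OF decseq_harm_diff_ln, of 0 "t - 1"] by (simp add: harm_def)

lemma sum_card_divisors_le: "(\<Sum>i=1..t. real (card {e. e dvd i})) \<le> real t * harm t"
proof -
  have "(\<Sum>i=1..t. real (card {e. e dvd i})) = (\<Sum>i=1..t. \<Sum>e | e dvd i. 1)" by simp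
  also have "\<dots> = (\<Sum>e=1..t. real (t div e))" by (subst sum_sum_divisors) simp
  also have "\<dots> \<le> (\<Sum>e=1..t. real t / real e)" by (intro sum_mono) (metis of_nat_div_le_of_nat)
  also have "\<dots> = real t * harm t" by (simp add: harm_def sum_distrib_left divide_inverse)
  finally show ?thesis .
qed

lemma inverse_div_le:
  assumes "0 < e" "e \<le> t"
  shows "1 / real (t div e) \<le> 2 * real e / real t"
proof -
  have quot: "t div e > 0" using assms by (simp add: div_greater_zero_iff)
  have "t < (t div e + 1) * e" using dividend_less_div_times[of e t] assms by simp
  then have "real t < real (t div e + 1) * real e"
    by (simp only: of_nat_less_iff of_nat_mult[symmetric])
  also have "\<dots> \<le> 2 * real (t div e) * real e" using quot by (intro mult_right_mono) auto
  finally show ?thesis using quot assms by (simp add: field_simps)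
qed

lemma sum_moebius_mu_over_squares_approx:
  assumes "t > 0"
  shows "\<bar>(\<Sum>e=1..t. of_int (moebius_mu e) / real e ^ 2) - 6 / pi ^ 2\<bar> \<le> 2 * harm t / real t"
proof -
  let ?z = "pi ^ 2 / 6 :: real"
  let ?Z = "\<lambda>m::nat. \<Sum>k=1..m. 1 / real k ^ 2"
  let ?tail = "\<lambda>e. ?z - ?Z (t div e)"
  let ?M = "\<Sum>e=1..t. of_int (moebius_mu e) / real e ^ 2"
  have "(\<Sum>e=1..t. of_int (moebius_mu e) / real e ^ 2 * ?Z (t div e)) = 1"
    using sum_moebius_mu_completely_multiplicative[of "\<lambda>e. 1 / real e ^ 2" t] assms
    by (simp add: power_mult_distrib)
  then have "?z * ?M - 1 = (\<Sum>e=1..t. of_int (moebius_mu e) / real e ^ 2 * ?tail e)"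
    by (simp add: sum_distrib_left sum_subtractf right_diff_distrib mult.commute)
  also have "\<bar>\<dots>\<bar> \<le> (\<Sum>e=1..t. \<bar>of_int (moebius_mu e) / real e ^ 2 * ?tail e\<bar>)"
    by (rule sum_abs)
  also have "\<dots> \<le> (\<Sum>e=1..t. 2 / real t * inverse (real e))"
  proof (rule sum_mono)
    fix e assume e_range: "e \<in> {1..t}"
    have "t div e > 0" using e_range by (simp add: div_greater_zero_iff)
    then have tail: "\<bar>?tail e\<bar> \<le> 2 * e / t"
      using zeta2_partial_sum_bounds[of "t div e"] inverse_div_le[of e t] e_range by auto
    have "\<bar>of_int (moebius_mu e) / real e ^ 2 * ?tail e\<bar>
        = \<bar>real_of_int (moebius_mu e)\<bar> / real e ^ 2 * \<bar>?tail e\<bar>"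
      by (simp add: abs_mult)
    also have "\<dots> \<le> 1 / real e ^ 2 * (2 * e / t)"
      using tail abs_moebius_mu_le_1 by (intro mult_mono divide_right_mono) auto
    also have "\<dots> = 2 / real t * inverse (real e)"
      using e_range by (simp add: power2_eq_square field_simps)
    finally show "\<bar>of_int (moebius_mu e) / real e ^ 2 * ?tail e\<bar> \<le> 2 / real t * inverse (real e)" .
  qed
  also have "\<dots> = 2 * harm t / real t" by (simp add: harm_def sum_distrib_left sum_divide_distrib)
  finally have scaled: "\<bar>?z * ?M - 1\<bar> \<le> 2 * harm t / real t" .
  have "1 \<le> ?z" using zeta2_partial_sum_bounds(1)[of 1] by simp
  then have "\<bar>?M - 6 / pi ^ 2\<bar> \<le> ?z * \<bar>?M - 6 / pi ^ 2\<bar>"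
    using mult_right_mono[of 1 ?z "\<bar>?M - 6 / pi ^ 2\<bar>"] by simp
  also have "\<dots> = \<bar>?z * (?M - 6 / pi ^ 2)\<bar>" by (simp add: abs_mult)
  also have "?z * (?M - 6 / pi ^ 2) = ?z * ?M - 1" by (simp add: right_diff_distrib)
  finally show ?thesis using scaled by linarith
qed

definition width :: "nat \<Rightarrow> real" where
  "width t = (\<Sum>i=1..t. real (t div i) * real i * real (totient i))"

lemma width_eq_sum_moebius_mu:
  "width t = (\<Sum>e=1..t. of_int (moebius_mu e) * real e * divisor_square_sum (t div e))"
proof -
  let ?F = "\<lambda>e f. of_int (moebius_mu e) * real e * (real (t div (e * f)) * real f ^ 2)"
  have "width t = (\<Sum>i=1..t. \<Sum>e | e dvd i. ?F e (i div e))"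
    unfolding width_def
  proof (rule sum.cong[OF refl])
    fix i assume "i \<in> {1..t}"
    then show "real (t div i) * real i * real (totient i) = (\<Sum>e | e dvd i. ?F e (i div e))"
      by (simp add: totient_eq_sum_moebius_mu sum_distrib_left) (auto intro!: sum.cong simp: power2_eq_square)
  qed
  also have "\<dots> = (\<Sum>e=1..t. \<Sum>f=1..t div e. ?F e f)" by (rule sum_sum_divisors)
  also have "\<dots> = (\<Sum>e=1..t. of_int (moebius_mu e) * real e * divisor_square_sum (t div e))"
    unfolding divisor_square_sum_def sum_div_mult[symmetric] sum_distrib_left div_mult2_eq ..
  finally show ?thesis .
qed

lemma width_approx_sum_moebius_mu:
  "\<bar>width t - zeta3 * real t ^ 3 / 3 * (\<Sum>e=1..t. of_int (moebius_mu e) / real e ^ 2)\<bar>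
    \<le> 3 * real t ^ 2 * harm t"
proof -
  let ?r = "\<lambda>e. divisor_square_sum (t div e) - zeta3 * (real t / e) ^ 3 / 3"
  have "width t - zeta3 * real t ^ 3 / 3 * (\<Sum>e=1..t. of_int (moebius_mu e) / real e ^ 2)
      = (\<Sum>e=1..t. of_int (moebius_mu e) * real e * ?r e)"
    unfolding width_eq_sum_moebius_mu sum_distrib_left sum_subtractf[symmetric]
    by (intro sum.cong refl) (auto simp: field_simps power2_eq_square power3_eq_cube)
  also have "\<bar>\<dots>\<bar> \<le> (\<Sum>e=1..t. \<bar>of_int (moebius_mu e) * real e * ?r e\<bar>)" by (rule sum_abs)
  also have "\<dots> \<le> (\<Sum>e=1..t. 3 * real t ^ 2 * inverse (real e))"
  proof (rule sum_mono)
    fix e assume e_range: "e \<in> {1..t}"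
    then have "1 \<le> real t / e" by simp
    moreover have "t div e = nat \<lfloor>real t / e\<rfloor>" by (simp add: floor_divide_of_nat_eq)
    ultimately have remainder: "\<bar>?r e\<bar> \<le> 3 * (real t / e) ^ 2"
      using divisor_square_sum_approx by simp
    have "\<bar>of_int (moebius_mu e) * real e * ?r e\<bar> = (\<bar>real_of_int (moebius_mu e)\<bar> * real e) * \<bar>?r e\<bar>"
      by (simp add: abs_mult)
    also have "\<dots> \<le> (1 * real e) * (3 * (real t / e) ^ 2)"
      using remainder abs_moebius_mu_le_1 by (intro mult_mono mult_right_mono) auto
    also have "\<dots> = 3 * real t ^ 2 * inverse (real e)"
      using e_range by (simp add: power2_eq_square field_simps)
    finally show "\<bar>of_int (moebius_mu e) * real e * ?r e\<bar> \<le> 3 * real t ^ 2 * inverse (real e)" .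
  qed
  also have "\<dots> = 3 * real t ^ 2 * harm t" by (simp add: harm_def sum_distrib_left)
  finally show ?thesis .
qed

lemma width_approx:
  assumes "t > 0"
  shows "\<bar>width t - 2 * zeta3 / pi ^ 2 * real t ^ 3\<bar> \<le> 5 * real t ^ 2 * harm t"
proof -
  let ?M = "\<Sum>e=1..t. of_int (moebius_mu e) / real e ^ 2"
  have "\<bar>zeta3 * real t ^ 3 / 3 * ?M - 2 * zeta3 / pi ^ 2 * real t ^ 3\<bar>
      = \<bar>zeta3 * real t ^ 3 / 3 * (?M - 6 / pi ^ 2)\<bar>" by (simp add: right_diff_distrib)
  also have "\<dots> = zeta3 * real t ^ 3 / 3 * \<bar>?M - 6 / pi ^ 2\<bar>"
    using zeta3_ge_1 by (simp add: abs_mult)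
  also have "\<dots> \<le> (2 * real t ^ 3 / 3) * (2 * harm t / real t)"
    using zeta3_ge_1 zeta3_le_2 sum_moebius_mu_over_squares_approx[OF assms]
    by (intro mult_mono divide_right_mono mult_right_mono) auto
  also have "\<dots> = 4 / 3 * real t ^ 2 * harm t"
    using assms by (simp add: power3_eq_cube power2_eq_square)
  also have "\<dots> \<le> 2 * real t ^ 2 * harm t" by (intro mult_right_mono) (auto simp: harm_nonneg)
  finally show ?thesis using width_approx_sum_moebius_mu[of t] by linarith
qed

definition width_error :: "nat \<Rightarrow> real" where
  "width_error t = 2 * real t ^ 2 * (1 + ln (real t))"

lemma c_g_cube: "c_g ^ 3 = pi ^ 2 / (2 * zeta3)" and c_g_pos: "0 < c_g"
  using zeta3_ge_1 by (simp_all add: c_g_def real_root_pow_pos2)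

lemma width_near_cube:
  assumes "t > 0"
  shows "\<bar>width t - (real t / c_g) ^ 3\<bar> \<le> 3 * width_error t"
proof -
  have "(real t / c_g) ^ 3 = 2 * zeta3 / pi ^ 2 * real t ^ 3" by (simp add: power_divide c_g_cube)
  then have "\<bar>width t - (real t / c_g) ^ 3\<bar> \<le> 5 * real t ^ 2 * harm t"
    using width_approx[OF assms] by simp
  also have "\<dots> \<le> 6 * real t ^ 2 * (1 + ln (real t))"
    using harm_le_ln[OF assms] by (intro mult_mono) (auto simp: harm_nonneg)
  finally show ?thesis by (simp add: width_error_def)
qed

subsection \<open>Peeling\<close>

lemma strict_minimum_extreme_point_of_convex_hull:
  fixes a p :: "'a::euclidean_space"
  assumes "p \<in> S" and less: "\<And>q. q \<in> S \<Longrightarrow> q \<noteq> p \<Longrightarrow> a \<bullet> p < a \<bullet> q"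
  shows "p extreme_point_of (convex hull S)"
proof (cases "S = {p}")
  case False
  define R where "R = S - {p}"
  have S_eq: "S = insert p R" "R \<noteq> {}" using assms(1) False by (auto simp: R_def)
  have R_less: "convex hull R \<subseteq> {q. a \<bullet> p < a \<bullet> q}"
    using less by (intro hull_minimal convex_halfspace_gt) (auto simp: R_def)
  have hull: "a \<bullet> p \<le> a \<bullet> x \<and> (a \<bullet> x = a \<bullet> p \<longrightarrow> x = p)" if x_in: "x \<in> convex hull S" for x
  proof -
    obtain u v q where coeffs: "0 \<le> u" "0 \<le> v" "u + v = 1"
      and x_comb: "q \<in> convex hull R" "x = u *\<^sub>R p + v *\<^sub>R q"
      using x_in unfolding S_eq(1) convex_hull_insert[OF S_eq(2)] by auto
    have u_eq: "u = 1 - v" using coeffs(3) by simp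
    have diff: "a \<bullet> x - a \<bullet> p = v * (a \<bullet> q - a \<bullet> p)"
      unfolding x_comb(2) u_eq by (simp add: inner_add_right left_diff_distrib right_diff_distrib)
    have "v = 0 \<Longrightarrow> x = p" using x_comb(2) u_eq by simp
    moreover have "v \<noteq> 0 \<Longrightarrow> 0 < a \<bullet> x - a \<bullet> p"
      unfolding diff using R_less x_comb(1) coeffs(2) by (intro mult_pos_pos) auto
    ultimately show ?thesis by (cases "v = 0") auto
  qed
  then show ?thesis
    using hull_inc[OF assms(1), of convex]
    by (intro extreme_point_of_Int_supporting_hyperplane_ge[where a = a and b = "a \<bullet> p"]) auto
qed simp

lemma vertical_open_segment:
  fixes x y z w :: real
  assumes "z < y" "y < w"
  shows "(x, y) \<in> open_segment (x, z) (x, w)"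
proof -
  define t where "t = (y - z) / (w - z)"
  have t_range: "0 < t" "t < 1" using assms by (auto simp: t_def)
  have "t * (w - z) = y - z" using assms by (simp add: t_def)
  then have "(x, y) = (1 - t) *\<^sub>R (x, z) + t *\<^sub>R (x, w)" by (simp add: algebra_simps)
  then show ?thesis unfolding in_segment using t_range assms by auto
qed

lemma above_segment_not_extreme_point:
  fixes x1 x2 x y1 y2 y w :: real
  assumes in_C: "convex C" "(x1, y1) \<in> C" "(x2, y2) \<in> C" "(x, w) \<in> C"
    and x_between: "x1 < x" "x < x2" and w_above: "y < w"
    and above: "(y2 - y) * (x - x1) + (y1 - y) * (x2 - x) \<le> 0"
  shows "\<not> (x, y) extreme_point_of C"
proof
  assume ext: "(x, y) extreme_point_of C"
  define t where "t = (x - x1) / (x2 - x1)"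
  define z where "z = (1 - t) * y1 + t * y2"
  have t_range: "0 < t" "t < 1" using x_between by (auto simp: t_def)
  have t_mult: "t * (x2 - x1) = x - x1" using x_between by (simp add: t_def)
  then have seg: "(x, z) = (1 - t) *\<^sub>R (x1, y1) + t *\<^sub>R (x2, y2)" by (simp add: z_def algebra_simps)
  have "(z - y) * (x2 - x1) = (y1 - y) * (x2 - x1) + t * (x2 - x1) * (y2 - y1)"
    by (simp add: z_def algebra_simps)
  also have "\<dots> = (y2 - y) * (x - x1) + (y1 - y) * (x2 - x)"
    unfolding t_mult by (simp add: algebra_simps)
  finally have "(z - y) * (x2 - x1) \<le> 0" using above by simp
  then have "z \<le> y" using x_between by (simp add: mult_le_0_iff)
  then consider "z = y" | "z < y" by linarith
  then show False
  proof cases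
    case on_segment: 1
    have "(x, y) \<in> open_segment (x1, y1) (x2, y2)"
      unfolding in_segment using seg t_range x_between on_segment by auto
    then show False using ext in_C(2,3) unfolding extreme_point_of_def by blast
  next
    case above_segment: 2
    have "(x, z) \<in> C" unfolding seg using in_C t_range by (intro convexD_alt) auto
    moreover have "(x, y) \<in> open_segment (x, z) (x, w)"
      using above_segment w_above by (rule vertical_open_segment)
    ultimately show False using ext in_C(4) unfolding extreme_point_of_def by blast
  qed
qed

lemma lattice_point_above_chord:
  fixes X1 Y1 X2 Y2 X Y :: int and s1 s2 :: real
  assumes X_between: "X1 < X" "X < X2"
    and below: "Y1 - s1 * X1 < Y - s1 * X" "Y2 - s2 * X2 < Y - s2 * X"
    and close: "(s2 - s1) * ((X2 - X) * (X - X1)) \<le> 1"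
  shows "(Y2 - Y) * (X - X1) + (Y1 - Y) * (X2 - X) \<le> 0"
proof -
  have pos: "0 < real_of_int (X - X1)" "0 < real_of_int (X2 - X)" using X_between by auto
  have "(real_of_int Y2 - Y) * (X - X1) < s2 * (X2 - X) * (X - X1)"
    using below(2) pos by (intro mult_strict_right_mono) (auto simp: algebra_simps)
  moreover have "(real_of_int Y1 - Y) * (X2 - X) < - s1 * (X - X1) * (X2 - X)"
    using below(1) pos by (intro mult_strict_right_mono) (auto simp: algebra_simps)
  moreover have "s2 * (X2 - X) * (X - X1) + - s1 * (X - X1) * (X2 - X) = (s2 - s1) * ((X2 - X) * (X - X1))"
    by (simp add: algebra_simps)
  ultimately have "real_of_int ((Y2 - Y) * (X - X1) + (Y1 - Y) * (X2 - X)) < 1"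
    using close by (simp only: of_int_add of_int_mult of_int_diff)
  then show ?thesis by linarith
qed

lemma convex_point_between:
  fixes C :: "(real \<times> real) set"
  assumes "convex C" "(x1, y1) \<in> C" "(x2, y2) \<in> C" "x1 \<le> x" "x \<le> x2"
    and "y1 - s * x1 \<le> B" "y2 - s * x2 \<le> B"
  obtains y where "(x, y) \<in> C" "y - s * x \<le> B"
proof (cases "x1 = x2")
  case True
  then show thesis using assms that[of y1] by auto
next
  case False
  define u where "u = (x - x1) / (x2 - x1)"
  have u_range: "0 \<le> u" "u \<le> 1" using assms False by (auto simp: u_def divide_le_eq)
  have "u * (x2 - x1) = x - x1" using False by (simp add: u_def)
  then have x_eq: "x = (1 - u) * x1 + u * x2" by (simp add: algebra_simps)
  define y where "y = (1 - u) * y1 + u * y2"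
  have "(x, y) = (1 - u) *\<^sub>R (x1, y1) + u *\<^sub>R (x2, y2)" by (simp add: x_eq y_def)
  then have "(x, y) \<in> C" using convexD_alt[of C "(x1, y1)" "(x2, y2)" u] assms u_range by simp
  moreover have "y - s * x = (1 - u) * (y1 - s * x1) + u * (y2 - s * x2)"
    by (simp add: x_eq y_def algebra_simps)
  then have "y - s * x \<le> (1 - u) * B + u * B"
    using assms u_range by (auto intro!: add_mono mult_left_mono)
  ultimately show thesis using that by (simp add: algebra_simps)
qed

abbreviation pt :: "int \<times> int \<Rightarrow> real \<times> real" where
  "pt p \<equiv> (real_of_int (fst p), real_of_int (snd p))"

lemma peel_subset: "peel S \<subseteq> S"
  by (auto simp: peel_def)

lemma peel_mono: "S \<subseteq> T \<Longrightarrow> peel S \<subseteq> peel T"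
proof
  fix p assume sub: "S \<subseteq> T" and "p \<in> peel S"
  then have p_kept: "p \<in> S" "\<not> p extreme_point_of (convex hull S)" by (auto simp: peel_def)
  have "convex hull S \<subseteq> convex hull T" using sub by (rule hull_mono)
  moreover have "p \<in> convex hull S" using p_kept(1) by (rule hull_inc)
  ultimately have "\<not> p extreme_point_of (convex hull T)"
    using p_kept(2) unfolding extreme_point_of_def by blast
  then show "p \<in> peel T" using p_kept sub by (auto simp: peel_def)
qed

lemma peel_pow_mono: "S \<subseteq> T \<Longrightarrow> (peel ^^ m) S \<subseteq> (peel ^^ m) T"
  by (induction m) (auto intro: peel_mono[THEN subsetD])

lemma extreme_point_of_injective_linear_image:
  fixes f :: "'a::real_vector \<Rightarrow> 'b::real_vector"
  assumes "linear f" "inj f"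
  shows "f p extreme_point_of (f ` S) \<longleftrightarrow> p extreme_point_of S"
  using assms by (simp add: extreme_point_of_def open_segment_linear_image inj_image_mem_iff)

lemma peel_translation: "peel ((+) v ` S) = (+) v ` peel S"
  by (auto simp: peel_def convex_hull_translation extreme_point_of_translation_eq)

lemma peel_scaleR:
  assumes "c \<noteq> 0"
  shows "peel ((*\<^sub>R) c ` S) = (*\<^sub>R) c ` peel S"
proof -
  have "linear ((*\<^sub>R) c)" and inj: "inj ((*\<^sub>R) c :: real \<times> real \<Rightarrow> _)"
    using assms by (auto simp: inj_def)
  then have "c *\<^sub>R p extreme_point_of (convex hull ((*\<^sub>R) c ` S))
      \<longleftrightarrow> p extreme_point_of (convex hull S)" for p
    unfolding convex_hull_scaling by (rule extreme_point_of_injective_linear_image)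
  then show ?thesis using inj by (auto simp: peel_def dest: injD)
qed

lemma peel_pow_translation: "(peel ^^ m) ((+) v ` S) = (+) v ` (peel ^^ m) S"
  by (induction m) (simp_all add: peel_translation)

lemma peel_pow_scaleR: "c \<noteq> 0 \<Longrightarrow> (peel ^^ m) ((*\<^sub>R) c ` S) = (*\<^sub>R) c ` (peel ^^ m) S"
  by (induction m) (simp_all add: peel_scaleR)

subsection \<open>Slopes\<close>

lemma exists_irrational_between:
  fixes a b :: real
  assumes "a < b"
  obtains x where "a < x" "x < b" "x \<notin> \<rat>"
proof -
  have "uncountable {a<..<b}" using assms by (simp add: uncountable_open_interval)
  then have "\<not> {a<..<b} \<subseteq> \<rat>" using countable_rat countable_subset by blast
  then show thesis by (auto intro: that)
qed

lemma irrational_mult_of_int: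
  fixes s :: real
  assumes "s \<notin> \<rat>" "s * of_int b = of_int a"
  shows "a = 0" "b = 0"
proof -
  show "b = 0"
  proof (rule ccontr)
    assume "b \<noteq> 0"
    then have "s = of_int a / of_int b" using assms(2) by (simp add: field_simps)
    then show False using assms(1) by (metis Rats_divide Rats_of_int)
  qed
  then show "a = 0" using assms(2) by simp
qed

lemma rational_mult_of_int_in_Ints_iff:
  fixes y0 i0 j :: int
  assumes "0 < i0" "coprime y0 i0"
  shows "of_int y0 / of_int i0 * of_int j \<in> (\<int> :: real set) \<longleftrightarrow> i0 dvd j"
proof
  assume "of_int y0 / of_int i0 * of_int j \<in> (\<int> :: real set)"
  then obtain k :: int where "of_int y0 / of_int i0 * of_int j = (of_int k :: real)"
    by (auto elim: Ints_cases)
  then have "real_of_int (y0 * j) = of_int (k * i0)" using assms(1) by (simp add: field_simps)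
  then have "y0 * j = k * i0" by (simp only: of_int_eq_iff)
  then show "i0 dvd j"
    using assms(2) by (metis coprime_commute coprime_dvd_mult_right_iff dvd_triv_right)
next
  assume "i0 dvd j"
  then obtain k where "j = i0 * k" ..
  then have "of_int y0 / of_int i0 * of_int j = real_of_int (y0 * k)" using assms(1) by simp
  then show "of_int y0 / of_int i0 * of_int j \<in> (\<int> :: real set)" by (metis Ints_of_int)
qed

lemma coprime_cross_mult_eq_iff:
  fixes i i0 y y0 :: int
  assumes "0 < i" "0 < i0" "coprime y i" "coprime y0 i0"
  shows "y * i0 = y0 * i \<longleftrightarrow> y = y0 \<and> i = i0"
proof
  assume cross_eq: "y * i0 = y0 * i"
  have "i0 dvd i"
    using cross_eq assms(4) by (metis coprime_commute coprime_dvd_mult_right_iff dvd_triv_right)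
  moreover have "i dvd i0"
    using cross_eq assms(3) by (metis coprime_commute coprime_dvd_mult_right_iff dvd_triv_right)
  ultimately have "i = i0" using assms(1,2) by (simp add: zdvd_antisym_nonneg)
  then show "y = y0 \<and> i = i0" using cross_eq assms(2) by simp
qed auto

text \<open>
  A slope \<open>s\<close> enters below only through the integers \<open>m j\<close>, \<open>j > 0\<close>, where \<open>m j\<close> is the largest integer
  on or below the line of slope \<open>s\<close> through the origin at abscissa \<open>j\<close>. As functions of \<open>s\<close> they are
  right-continuous; their left limits omit the points on the line.
\<close>

definition right_germ :: "real \<Rightarrow> int \<Rightarrow> int" where "right_germ s j = \<lfloor>s * j\<rfloor>"

definition left_germ :: "real \<Rightarrow> int \<Rightarrow> int" where "left_germ s j = \<lceil>s * j\<rceil> - 1"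

lemma right_germ_mono: "s \<le> s' \<Longrightarrow> 0 < j \<Longrightarrow> right_germ s j \<le> right_germ s' j"
  by (auto simp: right_germ_def intro!: floor_mono mult_right_mono)

lemma left_germ_le_right_germ: "left_germ s j \<le> right_germ s j"
  unfolding left_germ_def right_germ_def by linarith

lemma left_germ_irrational:
  assumes "s \<notin> \<rat>" "0 < j"
  shows "left_germ s j = right_germ s j"
proof -
  have "s * real_of_int j \<noteq> of_int \<lfloor>s * real_of_int j\<rfloor>"
    using irrational_mult_of_int(2)[OF assms(1)] assms(2) by force
  then show ?thesis by (simp add: left_germ_def right_germ_def ceiling_altdef)
qed

lemma eventually_right_germ_at_right:
  assumes "0 < j"
  shows "\<forall>\<^sub>F b in at_right s. right_germ b j = right_germ s j"
proof -
  have "((\<lambda>b. b * real_of_int j) \<longlongrightarrow> s * real_of_int j) (at_right s)" by (intro tendsto_intros)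
  then have "\<forall>\<^sub>F b in at_right s. b * real_of_int j < of_int \<lfloor>s * real_of_int j\<rfloor> + 1"
    by (rule order_tendstoD) linarith
  moreover have "\<forall>\<^sub>F b in at_right s. s < b" by (rule eventually_at_right_less)
  ultimately show ?thesis
  proof eventually_elim
    case (elim b)
    have "s * real_of_int j < b * real_of_int j" using elim(2) assms by simp
    then show ?case using elim(1) unfolding right_germ_def by (intro floor_unique) linarith+
  qed
qed

lemma eventually_right_germ_at_left:
  assumes "0 < j"
  shows "\<forall>\<^sub>F b in at_left s. right_germ b j = left_germ s j"
proof -
  have "((\<lambda>b. b * real_of_int j) \<longlongrightarrow> s * real_of_int j) (at_left s)" by (intro tendsto_intros)
  then have "\<forall>\<^sub>F b in at_left s. of_int \<lceil>s * real_of_int j\<rceil> - 1 < b * real_of_int j"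
    by (rule order_tendstoD) linarith
  moreover have "\<forall>\<^sub>F b in at_left s. b < s" by (simp add: eventually_at_filter)
  ultimately show ?thesis
  proof eventually_elim
    case (elim b)
    have "b * real_of_int j < s * real_of_int j" using elim(2) assms by simp
    then show ?case
      using elim(1) unfolding right_germ_def left_germ_def by (intro floor_unique) linarith+
  qed
qed

lemma right_germs_near:
  fixes s :: real and B :: int
  obtains d where "d > 0"
    "\<And>b j. s \<le> b \<Longrightarrow> b < s + d \<Longrightarrow> 0 < j \<Longrightarrow> j \<le> B \<Longrightarrow> right_germ b j = right_germ s j"
    "\<And>b j. s - d < b \<Longrightarrow> b < s \<Longrightarrow> 0 < j \<Longrightarrow> j \<le> B \<Longrightarrow> right_germ b j = left_germ s j"
proof -
  have "\<forall>\<^sub>F b in at_right s. \<forall>j\<in>{0<..B}. right_germ b j = right_germ s j"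
    by (intro eventually_ball_finite ballI eventually_right_germ_at_right) auto
  then obtain u where right_near: "s < u"
    "\<And>b j. s < b \<Longrightarrow> b < u \<Longrightarrow> 0 < j \<Longrightarrow> j \<le> B \<Longrightarrow> right_germ b j = right_germ s j"
    unfolding eventually_at_right_field by auto
  have "\<forall>\<^sub>F b in at_left s. \<forall>j\<in>{0<..B}. right_germ b j = left_germ s j"
    by (intro eventually_ball_finite ballI eventually_right_germ_at_left) auto
  then obtain l where left_near: "l < s"
    "\<And>b j. l < b \<Longrightarrow> b < s \<Longrightarrow> 0 < j \<Longrightarrow> j \<le> B \<Longrightarrow> right_germ b j = left_germ s j"
    unfolding eventually_at_left_field by auto
  show thesis
  proof (rule that[of "min (u - s) (s - l)"])
    show "0 < min (u - s) (s - l)" using right_near(1) left_near(1) by simp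
    show "right_germ b j = right_germ s j"
      if "s \<le> b" "b < s + min (u - s) (s - l)" "0 < j" "j \<le> B" for b j
      using that right_near(2)[of b j] by (cases "b = s") auto
    show "right_germ b j = left_germ s j"
      if "s - min (u - s) (s - l) < b" "b < s" "0 < j" "j \<le> B" for b j
      using that left_near(2)[of b j] by auto
  qed
qed

subsection \<open>The depth of a lattice point\<close>

locale strip =
  fixes r :: int
  assumes r_nonneg: "0 \<le> r"
begin

definition tau :: int where "tau = 2 * r + 1"

lemma tau_pos: "0 < tau" using r_nonneg by (simp add: tau_def)

lemma tau_div_nonneg: "0 < i \<Longrightarrow> 0 \<le> tau div i"
  using tau_pos by (simp add: pos_imp_zdiv_nonneg_iff)

lemma tau_less_div_mult: "0 < i \<Longrightarrow> tau < (tau div i + 1) * i"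
  using pos_mod_bound[of i tau] div_mult_mod_eq[of tau i] unfolding distrib_right by linarith

text \<open>
  \<open>(VX m, VY m)\<close> is the vertex with the tangent slope described by \<open>m\<close> on the polygon that is composed
  of all primitive vectors \<open>(i, y)\<close>, \<open>0 < i \<le> tau\<close>, each repeated \<open>tau div i\<close> times, in the order of slope.
  \<open>germ_ceiling m j\<close> is the least integer above the line of this slope through the origin at abscissa
  \<open>j\<close>. Up to a constant, \<open>depth m X Y\<close> counts the lattice points in the strip \<open>\<bar>x\<bar> \<le> r\<close> that lie on or
  below the line with this slope through \<open>(X - VX m, Y - VY m)\<close>.
\<close>

definition edge_sum :: "(int \<Rightarrow> int \<Rightarrow> int) \<Rightarrow> (int \<Rightarrow> int) \<Rightarrow> int" where
  "edge_sum w m = (\<Sum>i\<in>{0<..tau}. (tau div i) * signed_sum (\<lambda>y. of_bool (coprime y i) * w i y) (m i))"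

abbreviation "VX \<equiv> edge_sum (\<lambda>i y. i)"
abbreviation "VY \<equiv> edge_sum (\<lambda>i y. y)"

definition germ_ceiling :: "(int \<Rightarrow> int) \<Rightarrow> int \<Rightarrow> int" where
  "germ_ceiling m j = (if 0 < j then m j + 1 else if j < 0 then - m (- j) else 0)"

definition depth :: "(int \<Rightarrow> int) \<Rightarrow> int \<Rightarrow> int \<Rightarrow> int" where
  "depth m X Y = tau * (Y - VY m) - (\<Sum>j=X - VX m - r..X - VX m + r. germ_ceiling m j)"

abbreviation "Vx s \<equiv> VX (right_germ s)"
abbreviation "Vy s \<equiv> VY (right_germ s)"
abbreviation "depth_at s \<equiv> depth (right_germ s)"

lemma edge_sum_cong: "(\<And>j. 0 < j \<Longrightarrow> j \<le> tau \<Longrightarrow> m j = m' j) \<Longrightarrow> edge_sum w m = edge_sum w m'"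
  unfolding edge_sum_def by (rule sum.cong) auto

lemma germ_ceiling_cong: "(0 < \<bar>j\<bar> \<Longrightarrow> m \<bar>j\<bar> = m' \<bar>j\<bar>) \<Longrightarrow> germ_ceiling m j = germ_ceiling m' j"
  by (auto simp: germ_ceiling_def abs_if split: if_splits)

lemma depth_cong:
  assumes "\<And>j. 0 < j \<Longrightarrow> j \<le> B \<Longrightarrow> m j = m' j" "tau \<le> B" "\<bar>X - VX m\<bar> + r \<le> B"
  shows "depth m X Y = depth m' X Y"
proof -
  have edge_sum: "edge_sum w m = edge_sum w m'" for w using assms(1,2) by (intro edge_sum_cong) auto
  have "(\<Sum>j=X - VX m - r..X - VX m + r. germ_ceiling m j)
      = (\<Sum>j=X - VX m - r..X - VX m + r. germ_ceiling m' j)"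
    using assms(1,3) by (intro sum.cong germ_ceiling_cong) auto
  then show ?thesis by (simp add: depth_def edge_sum)
qed

lemma depth_shift: "depth m X (Y + c) = depth m X Y + tau * c"
  by (simp add: depth_def algebra_simps)

lemma edge_sum_diff:
  assumes "\<And>i. 0 < i \<Longrightarrow> i \<le> tau \<Longrightarrow> m i \<le> m' i"
  shows "edge_sum w m' - edge_sum w m
    = (\<Sum>i\<in>{0<..tau}. \<Sum>y | y \<in> {m i<..m' i} \<and> coprime y i. (tau div i) * w i y)"
proof -
  let ?f = "\<lambda>i y. of_bool (coprime y i) * w i y"
  have "edge_sum w m' - edge_sum w m
      = (\<Sum>i\<in>{0<..tau}. (tau div i) * (signed_sum (?f i) (m' i) - signed_sum (?f i) (m i)))"
    by (simp add: edge_sum_def sum_subtractf right_diff_distrib)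
  also have "\<dots> = (\<Sum>i\<in>{0<..tau}. (tau div i) * (\<Sum>y\<in>{m i<..m' i}. ?f i y))"
    using assms by (intro sum.cong refl) (simp add: signed_sum_diff)
  also have "\<dots> = (\<Sum>i\<in>{0<..tau}. \<Sum>y | y \<in> {m i<..m' i} \<and> coprime y i. (tau div i) * w i y)"
    by (simp add: sum_distrib_left Int_def)
  finally show ?thesis .
qed

lemma Vx_mono: "s \<le> s' \<Longrightarrow> Vx s \<le> Vx s'"
proof -
  assume "s \<le> s'"
  then have "Vx s' - Vx s
      = (\<Sum>i\<in>{0<..tau}. \<Sum>y | y \<in> {right_germ s i<..right_germ s' i} \<and> coprime y i. (tau div i) * i)"
    by (intro edge_sum_diff right_germ_mono)
  also have "\<dots> \<ge> 0" using tau_div_nonneg by (intro sum_nonneg) auto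
  finally show ?thesis by simp
qed

lemma edge_sum_jump_rational:
  assumes x_eq: "x = of_int y0 / of_int i0" and i0_pos: "0 < i0" and "coprime y0 i0"
  shows "edge_sum w (right_germ x) - edge_sum w (left_germ x) = (tau div i0) * w i0 y0"
proof -
  have crossed: "{y. y \<in> {left_germ x i<..right_germ x i} \<and> coprime y i} = (if i = i0 then {y0} else {})"
    if "0 < i" for i
  proof -
    have "y \<in> {left_germ x i<..right_germ x i} \<longleftrightarrow> y * i0 = y0 * i" for y
    proof -
      have "y \<in> {left_germ x i<..right_germ x i} \<longleftrightarrow> real_of_int y = x * i"
        unfolding left_germ_def right_germ_def by (auto simp: le_floor_iff) linarith+
      also have "\<dots> \<longleftrightarrow> real_of_int y * i0 = y0 * i" using i0_pos by (simp add: x_eq field_simps)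
      also have "\<dots> \<longleftrightarrow> y * i0 = y0 * i" by (metis of_int_eq_iff of_int_mult)
      finally show ?thesis .
    qed
    then show ?thesis
      using coprime_cross_mult_eq_iff[OF that i0_pos _ assms(3)] assms(3)
      by (auto simp: mult.commute)
  qed
  have "edge_sum w (right_germ x) - edge_sum w (left_germ x)
      = (\<Sum>i\<in>{0<..tau}. \<Sum>y | y \<in> {left_germ x i<..right_germ x i} \<and> coprime y i. (tau div i) * w i y)"
    by (intro edge_sum_diff left_germ_le_right_germ)
  also have "\<dots> = (\<Sum>i\<in>{0<..tau}. if i = i0 then (tau div i0) * w i0 y0 else 0)"
    by (intro sum.cong refl, subst crossed) auto
  also have "\<dots> = (tau div i0) * w i0 y0" using i0_pos tau_pos by (auto intro: div_pos_pos_trivial)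
  finally show ?thesis .
qed

lemma germ_jump_irrational:
  assumes "x \<notin> \<rat>"
  shows "edge_sum w (right_germ x) = edge_sum w (left_germ x)"
    and "depth (right_germ x) X Y = depth (left_germ x) X Y"
proof -
  have "right_germ x j = left_germ x j" if "0 < j" for j
    using left_germ_irrational[OF assms that] by simp
  then show "edge_sum w (right_germ x) = edge_sum w (left_germ x)"
    "depth (right_germ x) X Y = depth (left_germ x) X Y"
    by (auto intro!: edge_sum_cong depth_cong[OF _ max.cobounded1 max.cobounded2])
qed

lemma germ_ceiling_rational:
  assumes x_eq: "x = of_int y0 / of_int i0" and "0 < i0" "coprime y0 i0"
  shows "germ_ceiling (left_germ x) j = \<lceil>x * of_int j\<rceil> + of_bool (i0 dvd j \<and> j < 0)"
    and "germ_ceiling (right_germ x) j = \<lceil>x * of_int j\<rceil> + of_bool (i0 dvd j \<and> 0 < j)"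
proof -
  have ceiling: "\<lceil>x * of_int j\<rceil> = \<lfloor>x * of_int j\<rfloor> + of_bool (\<not> i0 dvd j)"
    using rational_mult_of_int_in_Ints_iff[OF assms(2,3), of j]
    by (auto simp: x_eq ceiling_altdef Ints_def)
  have minus: "\<lfloor>x * of_int (- j)\<rfloor> = - \<lceil>x * of_int j\<rceil>" "\<lceil>x * of_int (- j)\<rceil> = - \<lfloor>x * of_int j\<rfloor>"
    by (simp_all add: ceiling_def)
  show "germ_ceiling (left_germ x) j = \<lceil>x * of_int j\<rceil> + of_bool (i0 dvd j \<and> j < 0)"
    "germ_ceiling (right_germ x) j = \<lceil>x * of_int j\<rceil> + of_bool (i0 dvd j \<and> 0 < j)"
    unfolding germ_ceiling_def left_germ_def right_germ_def minus by (auto simp: ceiling)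
qed

lemma depth_jump_rational:
  fixes X Y :: int
  assumes x_eq: "x = of_int y0 / of_int i0" and i0_pos: "0 < i0" and "coprime y0 i0"
  defines "u \<equiv> X - VX (left_germ x)" and "u' \<equiv> X - VX (right_germ x)"
  shows "depth (right_germ x) X Y - depth (left_germ x) X Y =
    int (card {j\<in>{u-r..u+r}. i0 dvd j \<and> j < 0}) - int (card {j\<in>{u'-r..u'+r}. i0 dvd j \<and> 0 < j})"
proof -
  let ?q = "tau div i0"
  have u'_eq: "u' = u - ?q * i0"
    using edge_sum_jump_rational[OF assms(1-3), of "\<lambda>i y. i"] by (simp add: u_def u'_def)
  have VY_jump: "VY (right_germ x) = VY (left_germ x) + ?q * y0"
    using edge_sum_jump_rational[OF assms(1-3), of "\<lambda>i y. y"] by simp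
  have shift: "\<lceil>x * of_int (j - ?q * i0)\<rceil> = \<lceil>x * of_int j\<rceil> - ?q * y0" for j
  proof -
    have "x * of_int (j - ?q * i0) = x * of_int j - of_int (?q * y0)"
      using i0_pos by (simp add: x_eq field_simps)
    then show ?thesis by (metis ceiling_diff_of_int)
  qed
  have "(\<Sum>j=u'-r..u'+r. \<lceil>x * of_int j\<rceil>) = (\<Sum>j=u-r..u+r. \<lceil>x * of_int (j - ?q * i0)\<rceil>)"
    by (rule sum.reindex_bij_witness[of _ "\<lambda>j. j - ?q * i0" "\<lambda>j. j + ?q * i0"]) (auto simp: u'_eq)
  also have "\<dots> = (\<Sum>j=u-r..u+r. \<lceil>x * of_int j\<rceil>) - tau * (?q * y0)"
    unfolding shift sum_subtractf using r_nonneg by (simp add: tau_def)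
  finally have ceilings: "(\<Sum>j=u'-r..u'+r. \<lceil>x * of_int j\<rceil>)
      = (\<Sum>j=u-r..u+r. \<lceil>x * of_int j\<rceil>) - tau * (?q * y0)" .
  have count: "(\<Sum>j=a..b. of_bool (P j)) = int (card {j\<in>{a..b}. P j})" for a b and P :: "int \<Rightarrow> bool"
    by (simp add: Int_def)
  have right: "(\<Sum>j=u'-r..u'+r. germ_ceiling (right_germ x) j) = (\<Sum>j=u'-r..u'+r. \<lceil>x * of_int j\<rceil>)
      + int (card {j\<in>{u'-r..u'+r}. i0 dvd j \<and> 0 < j})"
    unfolding germ_ceiling_rational[OF assms(1-3)] sum.distrib count ..
  have left: "(\<Sum>j=u-r..u+r. germ_ceiling (left_germ x) j) = (\<Sum>j=u-r..u+r. \<lceil>x * of_int j\<rceil>)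
      + int (card {j\<in>{u-r..u+r}. i0 dvd j \<and> j < 0})"
    unfolding germ_ceiling_rational[OF assms(1-3)] sum.distrib count ..
  show ?thesis
    unfolding depth_def u_def[symmetric] u'_def[symmetric] right left ceilings VY_jump
    by (simp add: algebra_simps)
qed

text \<open>
  Multiples of \<open>i0\<close> in a window of length \<open>tau\<close> are the only contributions to a jump, and one of
  the two counts vanishes unless the window has passed the strip. Hence, as a function of the slope,
  the depth of a point decreases until the window meets the strip and increases afterwards.
\<close>

lemma depth_left_le_right:
  assumes "X - VX (left_germ x) \<le> r"
  shows "depth (left_germ x) X Y \<le> depth (right_germ x) X Y"
proof (cases "x \<in> \<rat>")
  case True
  then obtain y0 i0 where rat: "x = of_int y0 / of_int i0" "0 < i0" "coprime y0 i0"
    by (rule Rats_cases')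
  let ?u = "X - VX (right_germ x)"
  have "?u + r < i0"
    using assms edge_sum_jump_rational[OF rat, of "\<lambda>i y. i"] tau_less_div_mult[OF rat(2)]
    by (simp add: tau_def algebra_simps)
  then have "{j\<in>{?u-r..?u+r}. i0 dvd j \<and> 0 < j} = {}" by (auto dest: zdvd_imp_le)
  then show ?thesis using depth_jump_rational[OF rat, of X Y] by (simp only:) simp
qed (simp add: germ_jump_irrational)

lemma depth_right_le_left:
  assumes "- r \<le> X - VX (right_germ x)"
  shows "depth (right_germ x) X Y \<le> depth (left_germ x) X Y"
proof (cases "x \<in> \<rat>")
  case True
  then obtain y0 i0 where rat: "x = of_int y0 / of_int i0" "0 < i0" "coprime y0 i0"
    by (rule Rats_cases')
  let ?u = "X - VX (left_germ x)"
  have window: "- i0 < ?u - r"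
    using assms edge_sum_jump_rational[OF rat, of "\<lambda>i y. i"] tau_less_div_mult[OF rat(2)]
    by (simp add: tau_def algebra_simps)
  have "\<not> (i0 dvd j \<and> j < 0)" if "?u - r \<le> j" for j
    using zdvd_imp_le[of i0 "- j"] window that by auto
  then have "{j\<in>{?u-r..?u+r}. i0 dvd j \<and> j < 0} = {}" by auto
  then show ?thesis using depth_jump_rational[OF rat, of X Y] by (simp only:) simp
qed (simp add: germ_jump_irrational)

lemma depth_near:
  obtains d where "d > 0"
    "\<And>b w. x \<le> b \<Longrightarrow> b < x + d \<Longrightarrow>
      edge_sum w (right_germ b) = edge_sum w (right_germ x) \<and> depth_at b X Y = depth_at x X Y"
    "\<And>b w. x - d < b \<Longrightarrow> b < x \<Longrightarrow>
      edge_sum w (right_germ b) = edge_sum w (left_germ x) \<and> depth_at b X Y = depth (left_germ x) X Y"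
proof -
  define B where "B = tau + (\<bar>X - VX (right_germ x)\<bar> + r) + (\<bar>X - VX (left_germ x)\<bar> + r)"
  have B_ge: "tau \<le> B" "\<bar>X - VX (right_germ x)\<bar> + r \<le> B" "\<bar>X - VX (left_germ x)\<bar> + r \<le> B"
    using r_nonneg tau_pos by (auto simp: B_def)
  have near: "edge_sum w (right_germ b) = edge_sum w m \<and> depth_at b X Y = depth m X Y"
    if "\<And>j. 0 < j \<Longrightarrow> j \<le> B \<Longrightarrow> right_germ b j = m j" "\<bar>X - VX m\<bar> + r \<le> B" for b m w
    using that B_ge(1) by (auto intro!: edge_sum_cong depth_cong[symmetric, where B = B])
  obtain d where d_near: "d > 0"
    "\<And>b j. x \<le> b \<Longrightarrow> b < x + d \<Longrightarrow> 0 < j \<Longrightarrow> j \<le> B \<Longrightarrow> right_germ b j = right_germ x j"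
    "\<And>b j. x - d < b \<Longrightarrow> b < x \<Longrightarrow> 0 < j \<Longrightarrow> j \<le> B \<Longrightarrow> right_germ b j = left_germ x j"
    using right_germs_near[of x B] by metis
  show thesis
  proof (rule that[OF d_near(1)])
    fix b w assume "x \<le> b" "b < x + d"
    then show "edge_sum w (right_germ b) = edge_sum w (right_germ x) \<and> depth_at b X Y = depth_at x X Y"
      using d_near(2) B_ge(2) by (intro near)
  next
    fix b w assume "x - d < b" "b < x"
    then show "edge_sum w (right_germ b) = edge_sum w (left_germ x) \<and> depth_at b X Y = depth (left_germ x) X Y"
      using d_near(3) B_ge(3) by (intro near)
  qed
qed

lemma depth_at_mono:
  assumes "a \<le> b"
  shows "X - Vx a \<le> r \<Longrightarrow> depth_at a X Y \<le> depth_at b X Y"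
    and "- r \<le> X - Vx b \<Longrightarrow> depth_at b X Y \<le> depth_at a X Y"
proof -
  let ?P = "\<lambda>a b. (X - Vx a \<le> r \<longrightarrow> depth_at a X Y \<le> depth_at b X Y)
    \<and> (- r \<le> X - Vx b \<longrightarrow> depth_at b X Y \<le> depth_at a X Y)"
  have "?P a b"
    using assms
  proof (induction a b rule: Bolzano)
    case (trans a b c)
    then show ?case using Vx_mono[of a b] Vx_mono[of b c] by auto
  next
    case (local x)
    obtain d where d_near: "d > 0"
      "\<And>b w. x \<le> b \<Longrightarrow> b < x + d \<Longrightarrow>
        edge_sum w (right_germ b) = edge_sum w (right_germ x) \<and> depth_at b X Y = depth_at x X Y"
      "\<And>b w. x - d < b \<Longrightarrow> b < x \<Longrightarrow>
        edge_sum w (right_germ b) = edge_sum w (left_germ x) \<and> depth_at b X Y = depth (left_germ x) X Y"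
      using depth_near[of x X Y] by metis
    have "?P a b" if "a \<le> x" "x \<le> b" "b - a < d" for a b
      using d_near(2)[of b] d_near(3)[of a] that
        depth_left_le_right[of X x Y] depth_right_le_left[of X x Y] by (cases "a = x") auto
    then show ?case using d_near(1) by blast
  qed
  then show "X - Vx a \<le> r \<Longrightarrow> depth_at a X Y \<le> depth_at b X Y"
    and "- r \<le> X - Vx b \<Longrightarrow> depth_at b X Y \<le> depth_at a X Y" by auto
qed

lemma depth_at_minimal:
  assumes "\<bar>X - Vx s\<bar> \<le> r"
  shows "depth_at s X Y \<le> depth_at s' X Y"
  using depth_at_mono(1)[of s s' X Y] depth_at_mono(2)[of s' s X Y] assms by (cases "s \<le> s'") auto

lemma Vx_growth:
  assumes "a \<le> b"
  shows "\<lfloor>b\<rfloor> - \<lfloor>a\<rfloor> \<le> Vx b - Vx a"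
proof -
  let ?h = "\<lambda>i. \<Sum>y | y \<in> {right_germ a i<..right_germ b i} \<and> coprime y i. (tau div i) * i"
  have "{y. y \<in> {right_germ a 1<..right_germ b 1} \<and> coprime y 1} = {\<lfloor>a\<rfloor><..\<lfloor>b\<rfloor>}"
    by (auto simp: right_germ_def)
  then have "?h 1 = tau * (\<lfloor>b\<rfloor> - \<lfloor>a\<rfloor>)" using floor_mono[OF assms] by simp
  moreover have "1 * (\<lfloor>b\<rfloor> - \<lfloor>a\<rfloor>) \<le> tau * (\<lfloor>b\<rfloor> - \<lfloor>a\<rfloor>)"
    using tau_pos floor_mono[OF assms] by (intro mult_right_mono) auto
  ultimately have "\<lfloor>b\<rfloor> - \<lfloor>a\<rfloor> \<le> ?h 1" by (simp only: mult_1)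
  also have "?h 1 \<le> (\<Sum>i\<in>{0<..tau}. ?h i)"
    using tau_pos tau_div_nonneg by (intro member_le_sum) (auto intro!: sum_nonneg)
  also have "\<dots> = Vx b - Vx a" using assms by (intro edge_sum_diff[symmetric] right_germ_mono)
  finally show ?thesis .
qed

lemma Vx_unbounded:
  obtains s and n :: nat where "s \<notin> \<rat>" "Vx s \<le> c" "c' \<le> Vx (s + real n)"
proof -
  obtain t :: real where t_irr: "t \<notin> \<rat>" using exists_irrational_between[of 0 1] by auto
  have growth: "Vx u + int k \<le> Vx (u + real k)" for u k
  proof -
    have "\<lfloor>u + real k\<rfloor> = \<lfloor>u\<rfloor> + int k" by (metis floor_add_int of_int_of_nat_eq)
    then show ?thesis using Vx_growth[of u "u + real k"] by simp
  qed
  define k l where "k = nat \<bar>Vx t - c\<bar>" and "l = nat \<bar>c' - Vx t\<bar>"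
  have "t - real k \<notin> \<rat>" using t_irr Rats_add[of "t - real k" "real k"] by auto
  moreover have "Vx (t - real k) \<le> c" using growth[of "t - real k" k] by (simp add: k_def)
  moreover have "c' \<le> Vx (t - real k + real (k + l))" using growth[of t l] by (simp add: l_def)
  ultimately show thesis by (rule that)
qed

lemma Vx_jump_le_tau: "VX (right_germ x) - VX (left_germ x) \<le> tau"
proof (cases "x \<in> \<rat>")
  case True
  then obtain y0 i0 where rat: "x = of_int y0 / of_int i0" "0 < i0" "coprime y0 i0"
    by (rule Rats_cases')
  have "tau div i0 * i0 \<le> tau"
    using rat(2) by (metis div_mult_mod_eq le_add_same_cancel1 pos_mod_sign)
  then show ?thesis using edge_sum_jump_rational[OF rat, of "\<lambda>i y. i"] by simp
next
  case False
  then show ?thesis using germ_jump_irrational(1)[OF False, of "\<lambda>i y. i"] tau_pos by simp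
qed

lemma exists_slope_over:
  obtains s where "s \<notin> \<rat>" "\<bar>X - Vx s\<bar> \<le> r"
proof -
  obtain s0 n where s0_range: "Vx s0 \<le> X - r - 1" "X - r \<le> Vx (s0 + real n)" by (rule Vx_unbounded)
  have "Vx a < X - r \<and> X - r \<le> Vx b \<longrightarrow> (\<exists>s. s \<notin> \<rat> \<and> \<bar>X - Vx s\<bar> \<le> r)" if "a \<le> b" for a b
    using that
  proof (induction a b rule: Bolzano)
    case (trans a b c)
    then show ?case by (cases "Vx b < X - r") auto
  next
    case (local x)
    obtain d where d_near: "d > 0"
      "\<And>b. x \<le> b \<Longrightarrow> b < x + d \<Longrightarrow> Vx b = VX (right_germ x)"
      "\<And>b. x - d < b \<Longrightarrow> b < x \<Longrightarrow> Vx b = VX (left_germ x)"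
      using depth_near[of x] by metis
    obtain t where t_near: "x < t" "t < x + d" "t \<notin> \<rat>"
      using exists_irrational_between[of x "x + d"] d_near(1) by auto
    have "\<bar>X - Vx t\<bar> \<le> r" if "a \<le> x" "x \<le> b" "b - a < d" "Vx a < X - r" "X - r \<le> Vx b" for a b
    proof -
      have "Vx b = VX (right_germ x)" using d_near(2)[of b] that by simp
      moreover have "a \<noteq> x" using calculation that by auto
      then have "Vx a = VX (left_germ x)" using d_near(3)[of a] that by simp
      moreover have "Vx t = VX (right_germ x)" using d_near(2)[of t] t_near by simp
      ultimately show ?thesis using Vx_jump_le_tau[of x] that by (simp add: tau_def)
    qed
    then show ?case using d_near(1) t_near(3) by blast
  qed
  from this[of s0 "s0 + real n"] show thesis using s0_range that by auto
qed

subsection \<open>Peeling the sets of given depth\<close>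

definition support :: "real \<Rightarrow> real" where "support s = real_of_int (Vy s) - s * real_of_int (Vx s)"

definition depth_set :: "int \<Rightarrow> (int \<times> int) set" where
  "depth_set k = {(X, Y). \<forall>s. k \<le> depth_at s X Y}"

definition strip_count :: "real \<Rightarrow> real \<Rightarrow> int" where
  "strip_count s y = (\<Sum>x=-r..r. \<lfloor>y + s * of_int x\<rfloor>)"

lemma sum_window: "(\<Sum>j=u - r..u + r. f j) = (\<Sum>x=-r..r. f (u - x))"
  by (rule sum.reindex_bij_witness[of _ "\<lambda>x. u - x" "\<lambda>j. u - j"]) auto

lemma sum_window_affine:
  fixes s c :: real
  shows "(\<Sum>j=u - r..u + r. s * real_of_int j + c) = tau * (s * u + c)"
proof -
  have "(\<Sum>x=-r..r. real_of_int x) = (\<Sum>x=-r..r. - real_of_int x)"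
    by (rule sum.reindex_bij_witness[of _ uminus uminus]) auto
  then have symmetric: "(\<Sum>x=-r..r. real_of_int x) = 0" by (simp add: sum_negf)
  have "(\<Sum>j=u - r..u + r. s * real_of_int j + c) = (\<Sum>x=-r..r. (s * u + c) - s * real_of_int x)"
    unfolding sum_window by (simp add: algebra_simps)
  also have "\<dots> = real (card {-r..r}) * (s * u + c) - s * (\<Sum>x=-r..r. real_of_int x)"
    by (simp only: sum_subtractf sum_constant sum_distrib_left)
  finally show ?thesis using symmetric r_nonneg by (simp add: tau_def)
qed

lemma depth_at_bounds:
  shows "real_of_int (depth_at s X Y) \<le> tau * (Y - s * X - support s)"
    and "tau * (Y - s * X - support s) - tau \<le> real_of_int (depth_at s X Y)"
proof -
  let ?W = "{X - Vx s - r..X - Vx s + r}"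
  let ?g = "germ_ceiling (right_germ s)"
  have germ: "s * of_int j + 0 \<le> of_int (?g j)" "of_int (?g j) \<le> s * of_int j + 1" for j
    unfolding germ_ceiling_def right_germ_def by (auto, linarith+)
  have lower: "tau * (s * (X - Vx s) + 0) \<le> (\<Sum>j\<in>?W. real_of_int (?g j))"
    unfolding sum_window_affine[symmetric] by (rule sum_mono) (rule germ)
  have upper: "(\<Sum>j\<in>?W. real_of_int (?g j)) \<le> tau * (s * (X - Vx s) + 1)"
    unfolding sum_window_affine[symmetric] by (rule sum_mono) (rule germ)
  have depth: "real_of_int (depth_at s X Y) = tau * (real_of_int Y - Vy s) - (\<Sum>j\<in>?W. real_of_int (?g j))"
    by (simp add: depth_def)
  have height: "tau * (Y - s * X - support s) = tau * (real_of_int Y - Vy s) - tau * (s * (X - Vx s))"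
    by (simp add: support_def algebra_simps)
  show "real_of_int (depth_at s X Y) \<le> tau * (Y - s * X - support s)"
    using lower unfolding depth height by simp
  show "tau * (Y - s * X - support s) - tau \<le> real_of_int (depth_at s X Y)"
    using upper unfolding depth height by (simp add: distrib_left)
qed

lemma depth_at_irrational:
  assumes "s \<notin> \<rat>"
  shows "depth_at s X Y = strip_count s (Y - s * X - support s)"
proof -
  have ceiling: "germ_ceiling (right_germ s) j = \<lceil>s * of_int j\<rceil>" for j
  proof -
    have "s * real_of_int j \<noteq> of_int \<lfloor>s * real_of_int j\<rfloor>" if "j \<noteq> 0"
      using irrational_mult_of_int(2)[OF assms, of j] that by metis
    then show ?thesis
      unfolding germ_ceiling_def right_germ_def by (auto simp: ceiling_altdef floor_minus)
  qed
  have "depth_at s X Y = (\<Sum>x=-r..r. (Y - Vy s) - germ_ceiling (right_germ s) (X - Vx s - x))"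
    unfolding depth_def sum_window using r_nonneg by (simp add: sum_subtractf tau_def)
  also have "\<dots> = strip_count s (Y - s * X - support s)"
    unfolding strip_count_def
  proof (rule sum.cong[OF refl])
    fix x
    have "Y - s * X - support s + s * of_int x = of_int (Y - Vy s) - s * of_int (X - Vx s - x)"
      by (simp add: support_def algebra_simps)
    then show "Y - Vy s - germ_ceiling (right_germ s) (X - Vx s - x)
        = \<lfloor>Y - s * X - support s + s * of_int x\<rfloor>"
      unfolding ceiling by (simp only: floor_diff_of_int ceiling_def) linarith
  qed
  finally show ?thesis .
qed

lemma strip_count_mono: "y \<le> y' \<Longrightarrow> strip_count s y \<le> strip_count s y'"
  unfolding strip_count_def by (intro sum_mono floor_mono) simp

lemma strip_count_strict:
  assumes "\<bar>x\<bar> \<le> r" "y' < of_int z - s * of_int x"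
  shows "strip_count s y' < strip_count s (of_int z - s * of_int x)"
  unfolding strip_count_def
proof (rule sum_strict_mono_ex1)
  show "\<forall>i\<in>{-r..r}. \<lfloor>y' + s * of_int i\<rfloor> \<le> \<lfloor>of_int z - s * of_int x + s * of_int i\<rfloor>"
    using assms by (auto intro: floor_mono)
  have "\<lfloor>y' + s * of_int x\<rfloor> < \<lfloor>of_int z - s * of_int x + s * of_int x\<rfloor>"
    using assms(2) by (simp add: floor_less_iff)
  then show "\<exists>i\<in>{-r..r}. \<lfloor>y' + s * of_int i\<rfloor> < \<lfloor>of_int z - s * of_int x + s * of_int i\<rfloor>"
    using assms(1) by (intro bexI[of _ x]) auto
qed simp

lemma strip_count_shift: "strip_count s (of_int z + y) = tau * z + strip_count s y"
proof -
  have "strip_count s (of_int z + y) = (\<Sum>x=-r..r. z + \<lfloor>y + s * of_int x\<rfloor>)"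
    unfolding strip_count_def by (rule sum.cong) (auto simp: add.assoc)
  then show ?thesis using r_nonneg by (simp add: sum.distrib strip_count_def tau_def)
qed

lemma strip_count_lattice_inj:
  assumes s_irr: "s \<notin> \<rat>" and x_in_strip: "\<bar>x\<bar> \<le> r" "\<bar>x'\<bar> \<le> r"
    and same_count: "strip_count s (of_int z - s * of_int x) = strip_count s (of_int z' - s * of_int x')"
  shows "x = x'"
proof -
  have "of_int z - s * of_int x = of_int z' - s * of_int x'"
    using strip_count_strict[OF x_in_strip(1), of "of_int z' - s * of_int x'" z s]
      strip_count_strict[OF x_in_strip(2), of "of_int z - s * of_int x" z' s] same_count
    by (cases rule: linorder_cases[of "of_int z - s * of_int x" "of_int z' - s * of_int x'"]) auto
  then have "s * of_int (x - x') = of_int (z - z')" by (simp add: algebra_simps)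
  from irrational_mult_of_int(2)[OF s_irr this] show "x = x'" by simp
qed

lemma strip_count_lattice_surj:
  assumes s_irr: "s \<notin> \<rat>"
  obtains x z where "\<bar>x\<bar> \<le> r" "strip_count s (of_int z - s * of_int x) = k"
proof -
  define count where "count z x = strip_count s (of_int z - s * of_int x)" for z x
  have shift: "count z x = tau * z + count 0 x" for z x
    using strip_count_shift[of s z "- s * of_int x"] by (simp add: count_def)
  define residue where "residue x = count 0 x mod tau" for x
  have "inj_on residue {-r..r}"
  proof (rule inj_onI)
    fix x x' assume xx': "x \<in> {-r..r}" "x' \<in> {-r..r}" and "residue x = residue x'"
    then have "tau dvd count 0 x' - count 0 x" unfolding residue_def by (metis mod_eq_dvd_iff)
    then obtain z where "count 0 x' - count 0 x = tau * z" ..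
    then have same_count: "count z x = count 0 x'" using shift[of z x] by simp
    show "x = x'"
      by (rule strip_count_lattice_inj[OF s_irr _ _ same_count[unfolded count_def]]) (use xx' in auto)
  qed
  moreover have "residue ` {-r..r} \<subseteq> {0..<tau}" using tau_pos by (auto simp: residue_def)
  ultimately have "residue ` {-r..r} = {0..<tau}"
    by (intro card_subset_eq) (auto simp: card_image tau_def)
  moreover have "k mod tau \<in> {0..<tau}" using tau_pos by simp
  ultimately obtain x where x_residue: "x \<in> {-r..r}" "residue x = k mod tau" by (metis imageE)
  then have "tau dvd k - count 0 x" unfolding residue_def by (metis mod_eq_dvd_iff)
  then obtain z where "k - count 0 x = tau * z" ..
  then have "strip_count s (of_int z - s * of_int x) = k" using shift[of z x] by (simp add: count_def)
  then show thesis using that[of x z] x_residue(1) by auto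
qed

lemma depth_set_Suc: "(X, Y) \<in> depth_set k \<Longrightarrow> (X, Y + 1) \<in> depth_set k"
  using tau_pos by (auto simp: depth_set_def depth_shift intro: add_increasing2)

lemma depth_set_antimono: "k \<le> l \<Longrightarrow> depth_set l \<subseteq> depth_set k"
  by (auto simp: depth_set_def intro: order_trans)

lemma extreme_point_if_exact_depth:
  assumes "(X, Y) \<in> depth_set k" "(X, Y) \<notin> depth_set (k + 1)"
  shows "pt (X, Y) extreme_point_of (convex hull (pt ` depth_set k))"
proof -
  obtain s0 where shallow: "depth_at s0 X Y < k + 1"
    using assms(2) by (auto simp: depth_set_def not_le)
  obtain s where s_over: "s \<notin> \<rat>" "\<bar>X - Vx s\<bar> \<le> r" by (rule exists_slope_over)
  have exact: "depth_at s X Y \<le> k" using depth_at_minimal[OF s_over(2), of Y s0] shallow by linarith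
  have height: "Y - s * X - support s = of_int (Y - Vy s) - s * of_int (X - Vx s)"
    by (simp add: support_def algebra_simps)
  have lowest: "Y - s * X < Y' - s * X'"
    if q_in: "(X', Y') \<in> depth_set k" "(X', Y') \<noteq> (X, Y)" for X' Y'
  proof (rule ccontr)
    assume "\<not> Y - s * X < Y' - s * X'"
    then consider "Y' - s * X' < Y - s * X" | "Y' - s * X' = Y - s * X" by linarith
    then show False
    proof cases
      case lower: 1
      then have "Y' - s * X' - support s < of_int (Y - Vy s) - s * of_int (X - Vx s)"
        using height by simp
      from strip_count_strict[OF s_over(2) this] have "depth_at s X' Y' < depth_at s X Y"
        using depth_at_irrational[OF s_over(1)] height by metis
      moreover have "k \<le> depth_at s X' Y'" using q_in(1) by (simp add: depth_set_def)
      ultimately show False using exact by linarith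
    next
      case level: 2
      then have "s * of_int (X' - X) = of_int (Y' - Y)" by (simp add: algebra_simps)
      from irrational_mult_of_int[OF s_over(1) this] show False using q_in(2) by auto
    qed
  qed
  show ?thesis
  proof (rule strict_minimum_extreme_point_of_convex_hull[where a = "(- s, 1)"])
    show "pt (X, Y) \<in> pt ` depth_set k" using assms(1) by (rule imageI)
    show "(- s, 1) \<bullet> pt (X, Y) < (- s, 1) \<bullet> q" if "q \<in> pt ` depth_set k" "q \<noteq> pt (X, Y)" for q
      using that lowest by fastforce
  qed
qed

text \<open>
  Since the depth of a point is smallest at the slopes whose window meets the strip, the \<open>k\<close>-th strip
  point in the order of height above lines of slope \<open>s\<close>, shifted to \<open>(Vx s, Vy s)\<close>, has depth
  exactly \<open>k\<close>.
\<close>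

lemma exists_vertex:
  assumes s_irr: "s \<notin> \<rat>"
  shows "\<exists>p. p \<in> depth_set k \<and> \<bar>fst p - Vx s\<bar> \<le> r \<and> depth_at s (fst p) (snd p) = k"
proof -
  obtain x z where x_in_strip: "\<bar>x\<bar> \<le> r" and count: "strip_count s (of_int z - s * of_int x) = k"
    using strip_count_lattice_surj[OF s_irr] by blast
  have "real_of_int (Vy s + z) - s * real_of_int (Vx s + x) - support s = of_int z - s * of_int x"
    by (simp add: support_def algebra_simps)
  then have depth: "depth_at s (Vx s + x) (Vy s + z) = k"
    using depth_at_irrational[OF s_irr, of "Vx s + x" "Vy s + z"] count by metis
  have "k \<le> depth_at s' (Vx s + x) (Vy s + z)" for s'
    using depth_at_minimal[of "Vx s + x" s "Vy s + z" s'] x_in_strip depth by simp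
  then show ?thesis
    using depth x_in_strip by (intro exI[of _ "(Vx s + x, Vy s + z)"]) (auto simp: depth_set_def)
qed

definition vertex :: "int \<Rightarrow> real \<Rightarrow> int \<times> int" where
  "vertex k s = (SOME p. p \<in> depth_set k \<and> \<bar>fst p - Vx s\<bar> \<le> r \<and> depth_at s (fst p) (snd p) = k)"

lemma
  assumes "s \<notin> \<rat>"
  shows vertex_in_depth_set: "vertex k s \<in> depth_set k"
    and vertex_near_Vx: "\<bar>fst (vertex k s) - Vx s\<bar> \<le> r"
    and depth_at_vertex: "depth_at s (fst (vertex k s)) (snd (vertex k s)) = k"
  using someI_ex[OF exists_vertex[OF assms, of k]] by (simp_all add: vertex_def)

lemma vertex_below:
  assumes s_irr: "s \<notin> \<rat>" and "(X, Y) \<in> depth_set (k + 1)"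
  shows "real_of_int (snd (vertex k s)) - s * real_of_int (fst (vertex k s))
    < real_of_int Y - s * real_of_int X"
proof (rule ccontr)
  assume "\<not> ?thesis"
  then have "depth_at s X Y \<le> depth_at s (fst (vertex k s)) (snd (vertex k s))"
    unfolding depth_at_irrational[OF s_irr] by (intro strip_count_mono) simp
  moreover have "k + 1 \<le> depth_at s X Y" using assms(2) by (simp add: depth_set_def)
  ultimately show False using depth_at_vertex[OF s_irr] by simp
qed

lemma vertices_around:
  obtains s1 s2 where "s1 \<notin> \<rat>" "s2 \<notin> \<rat>" "fst (vertex k s1) \<le> X" "X < fst (vertex k s2)"
    "(s2 - s1) * ((fst (vertex k s2) - X) * (X - fst (vertex k s1))) \<le> 1"
proof -
  obtain s0 n where s0_range: "s0 \<notin> \<rat>" "Vx s0 \<le> X - r" "X + r + 1 \<le> Vx (s0 + real n)"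
    by (rule Vx_unbounded)
  define B where "B = \<bar>Vx s0\<bar> + \<bar>Vx (s0 + n)\<bar> + \<bar>X\<bar> + r"
  have B_nonneg: "0 \<le> B" using r_nonneg by (simp add: B_def)
  have B_bound: "\<bar>fst (vertex k s) - X\<bar> \<le> B" if "s0 \<le> s" "s \<le> s0 + n" "s \<notin> \<rat>" for s
    using vertex_near_Vx[OF that(3), of k] Vx_mono[OF that(1)] Vx_mono[OF that(2)] by (auto simp: B_def)
  define Q where "Q = nat (B * B + 1)"
  have Q_eq: "real Q = B * B + 1" "0 < Q" using B_nonneg by (auto simp: Q_def)
  define s where "s j = s0 + real j / real Q" for j
  have irrational: "s j \<notin> \<rat>" for j
    using s0_range(1) Rats_diff[of "s j" "real j / real Q"] by (auto simp: s_def)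
  have "\<not> X < fst (vertex k (s 0))"
    using vertex_near_Vx[OF s0_range(1), of k] s0_range(2) by (simp add: s_def)
  moreover have "X < fst (vertex k (s (n * Q)))"
    using vertex_near_Vx[OF irrational, of k "n * Q"] s0_range(3) Q_eq(2) by (simp add: s_def)
  ultimately obtain j where j_step: "j < n * Q"
    "\<not> X < fst (vertex k (s j))" "X < fst (vertex k (s (Suc j)))"
    using ex_least_nat_less[of "\<lambda>j. X < fst (vertex k (s j))" "n * Q"] by blast
  have range: "s0 \<le> s i" "s i \<le> s0 + n" if "i \<le> n * Q" for i
  proof -
    have "real i \<le> real n * real Q" using that by (metis of_nat_le_iff of_nat_mult)
    then show "s0 \<le> s i" "s i \<le> s0 + n" using Q_eq(2) by (simp_all add: s_def divide_le_eq)
  qed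
  let ?gap = "(fst (vertex k (s (Suc j))) - X) * (X - fst (vertex k (s j)))"
  have "?gap \<le> B * B"
    using B_bound[OF range irrational, of j] B_bound[OF range irrational, of "Suc j"] j_step B_nonneg
    by (intro mult_mono) auto
  then have "real_of_int ?gap \<le> Q" using Q_eq(1) by (simp flip: of_int_mult)
  moreover have "s (Suc j) - s j = 1 / Q" by (simp add: s_def diff_divide_distrib[symmetric])
  ultimately have "(s (Suc j) - s j) * ?gap \<le> 1" using Q_eq(2) by (simp add: divide_le_eq)
  then show thesis using j_step irrational by (intro that[of "s j" "s (Suc j)"]) auto
qed

text \<open>
  Both vertices lie below the lines through a deeper point \<open>(X, Y)\<close> with their respective slopes. These
  differ so little that integrality puts \<open>(X, Y)\<close> on or above the segment between the vertices.
\<close>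

lemma not_extreme_point_if_deeper:
  assumes deeper: "(X, Y) \<in> depth_set (k + 1)"
  shows "\<not> pt (X, Y) extreme_point_of (convex hull (pt ` depth_set k))"
proof -
  let ?C = "convex hull (pt ` depth_set k)"
  obtain s1 s2 where irrational: "s1 \<notin> \<rat>" "s2 \<notin> \<rat>"
    and X_between: "fst (vertex k s1) \<le> X" "X < fst (vertex k s2)"
    and close: "(s2 - s1) * ((fst (vertex k s2) - X) * (X - fst (vertex k s1))) \<le> 1"
    by (rule vertices_around)
  obtain X1 Y1 X2 Y2 where v: "vertex k s1 = (X1, Y1)" "vertex k s2 = (X2, Y2)" by fastforce
  have in_hull: "pt p \<in> ?C" if "p \<in> depth_set k" for p using that by (intro hull_inc imageI)
  have above_in_hull: "pt (X, Y + 1) \<in> ?C"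
    using depth_set_Suc[OF deeper] depth_set_antimono[of k "k + 1"] by (intro in_hull) auto
  have vertices_in_hull: "pt (X1, Y1) \<in> ?C" "pt (X2, Y2) \<in> ?C"
    using in_hull[OF vertex_in_depth_set[OF irrational(1)]] in_hull[OF vertex_in_depth_set[OF irrational(2)]]
    unfolding v .
  have below: "Y1 - s1 * X1 < Y - s1 * X" "Y2 - s2 * X2 < Y - s2 * X"
    using vertex_below[OF irrational(1) deeper] vertex_below[OF irrational(2) deeper] by (simp_all add: v)
  show ?thesis
  proof (cases "X1 = X")
    case True
    then have "pt (X, Y) \<in> open_segment (pt (X1, Y1)) (pt (X, Y + 1))"
      using vertical_open_segment[of Y1 Y "Y + 1" X] below(1) by simp
    then show ?thesis using above_in_hull vertices_in_hull(1) unfolding extreme_point_of_def by blast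
  next
    case False
    then have X_strict: "X1 < X" "X < X2" using X_between by (auto simp: v)
    then have "(Y2 - Y) * (X - X1) + (Y1 - Y) * (X2 - X) \<le> 0"
      using below close by (intro lattice_point_above_chord) (auto simp: v)
    then have "real_of_int ((Y2 - Y) * (X - X1) + (Y1 - Y) * (X2 - X)) \<le> 0" by (simp only: of_int_le_0_iff)
    then show ?thesis
      using above_segment_not_extreme_point[of ?C X1 Y1 X2 Y2 X "Y + 1" Y]
        vertices_in_hull above_in_hull X_strict by simp
  qed
qed

lemma peel_depth_set: "peel (pt ` depth_set k) = pt ` depth_set (k + 1)"
proof -
  have "pt p \<in> peel (pt ` depth_set k) \<longleftrightarrow> p \<in> depth_set (k + 1)" if "p \<in> depth_set k" for p
    using that extreme_point_if_exact_depth[of "fst p" "snd p" k]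
      not_extreme_point_if_deeper[of "fst p" "snd p" k]
    by (auto simp: peel_def)
  moreover have "peel (pt ` depth_set k) \<subseteq> pt ` depth_set k" by (rule peel_subset)
  moreover have "depth_set (k + 1) \<subseteq> depth_set k" by (rule depth_set_antimono) simp
  ultimately show ?thesis by blast
qed

lemma peel_pow_depth_set: "(peel ^^ n) (pt ` depth_set k) = pt ` depth_set (k + n)"
  by (induction n) (simp_all add: peel_depth_set add.assoc add.commute[of 1])

end

subsection \<open>The support function of the vertex polygon\<close>

lemma abs_diff_le_if_quadratic_error:
  fixes F :: "real \<Rightarrow> real"
  assumes local: "\<And>x y. x \<le> y \<Longrightarrow> \<bar>F y - F x\<bar> \<le> M * (y - x) + c * (y - x)\<^sup>2"
  shows "\<bar>F y - F x\<bar> \<le> M * \<bar>y - x\<bar>"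
proof -
  have ordered: "\<bar>F b - F a\<bar> \<le> M * (b - a)" if "a \<le> b" for a b
  proof (rule LIMSEQ_le_const)
    show "(\<lambda>n. M * (b - a) + c * (b - a)\<^sup>2 / real n) \<longlonglongrightarrow> M * (b - a)"
      using tendsto_add[OF tendsto_const lim_const_over_n] by force
    \<comment> \<open>Subdividing \<open>[a, b]\<close> into \<open>n\<close> equal parts divides the quadratic error by \<open>n\<close>.\<close>
    have "\<bar>F b - F a\<bar> \<le> M * (b - a) + c * (b - a)\<^sup>2 / real n" if "n > 0" for n :: nat
    proof -
      define x where "x i = a + real i * ((b - a) / n)" for i
      have step: "x (Suc i) - x i = (b - a) / n" for i
        by (simp add: x_def distrib_right del: times_divide_eq_right)
      have "F b - F a = (\<Sum>i<n. F (x (Suc i)) - F (x i))"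
        using that sum_lessThan_telescope[of "\<lambda>i. F (x i)" n] by (simp add: x_def)
      also have "\<bar>\<dots>\<bar> \<le> (\<Sum>i<n. \<bar>F (x (Suc i)) - F (x i)\<bar>)" by (rule sum_abs)
      also have "\<dots> \<le> (\<Sum>i<n. M * ((b - a) / n) + c * ((b - a) / n)\<^sup>2)"
      proof (rule sum_mono)
        fix i
        have "0 \<le> (b - a) / n" using \<open>a \<le> b\<close> by simp
        then show "\<bar>F (x (Suc i)) - F (x i)\<bar> \<le> M * ((b - a) / n) + c * ((b - a) / n)\<^sup>2"
          using local[of "x i" "x (Suc i)"] unfolding step[of i, symmetric] by simp
      qed
      also have "\<dots> = M * (b - a) + c * (b - a)\<^sup>2 / real n"
        using that by (simp add: power2_eq_square field_simps)
      finally show ?thesis .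
    qed
    then show "\<exists>N. \<forall>n\<ge>N. \<bar>F b - F a\<bar> \<le> M * (b - a) + c * (b - a)\<^sup>2 / real n"
      by (intro exI[of _ 1]) auto
  qed
  then show ?thesis
    using ordered[of x y] ordered[of y x] by (cases "x \<le> y") (auto simp: abs_minus_commute)
qed

lemma concave_quadratic_estimate:
  fixes S V :: "real \<Rightarrow> real"
  assumes concave: "\<And>a b. S b \<le> S a - (b - a) * V a"
    and linear: "\<And>a b. \<bar>V a - V b - H * (a - b)\<bar> \<le> M"
  shows "\<bar>S s - S s0 + V s0 * (s - s0) + H * (s - s0)\<^sup>2 / 2\<bar> \<le> M * \<bar>s - s0\<bar>"
proof -
  define F where "F x = S x + V s0 * (x - s0) + H * (x - s0)\<^sup>2 / 2" for x
  have "\<bar>F b - F a\<bar> \<le> M * (b - a) + \<bar>H\<bar> / 2 * (b - a)\<^sup>2" if "a \<le> b" for a b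
  proof -
    have F_diff: "F b - F a = S b - S a + (b - a) * (V s0 + H * ((a + b) / 2 - s0))"
      by (simp add: F_def power2_eq_square field_simps)
    have abs_H: "\<bar>H * (b - a)\<^sup>2\<bar> = \<bar>H\<bar> * (b - a)\<^sup>2" by (simp add: abs_mult)
    have "V s0 - V a + H * (a - s0) \<le> M"
      using linear[of s0 a] by (simp add: abs_le_iff algebra_simps)
    then have "(b - a) * (V s0 - V a + H * (a - s0)) \<le> (b - a) * M"
      using that by (intro mult_left_mono) auto
    moreover have "F b - F a \<le> (b - a) * (V s0 - V a + H * (a - s0)) + H * (b - a)\<^sup>2 / 2"
      unfolding F_diff using concave[of b a] by (simp add: power2_eq_square field_simps)
    ultimately have upper: "F b - F a \<le> M * (b - a) + \<bar>H\<bar> / 2 * (b - a)\<^sup>2"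
      using abs_H by (simp add: mult.commute)
    have "- M \<le> V s0 - V b + H * (b - s0)"
      using linear[of s0 b] by (simp add: abs_le_iff algebra_simps)
    then have "(b - a) * (- M) \<le> (b - a) * (V s0 - V b + H * (b - s0))"
      using that by (intro mult_left_mono) auto
    moreover have "(b - a) * (V s0 - V b + H * (b - s0)) - H * (b - a)\<^sup>2 / 2 \<le> F b - F a"
      unfolding F_diff using concave[of a b] by (simp add: power2_eq_square field_simps)
    ultimately have "- (M * (b - a) + \<bar>H\<bar> / 2 * (b - a)\<^sup>2) \<le> F b - F a"
      using abs_H by (simp add: mult.commute)
    then show ?thesis using upper by linarith
  qed
  then have "\<bar>F s - F s0\<bar> \<le> M * \<bar>s - s0\<bar>" by (rule abs_diff_le_if_quadratic_error)
  then show ?thesis by (simp add: F_def)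
qed

context strip
begin

abbreviation "H \<equiv> width (nat tau)"
abbreviation "err \<equiv> width_error (nat tau)"

lemma Vx_approx: "\<bar>real_of_int (Vx s) - s * H\<bar> \<le> err / 2"
proof -
  define t where "t = nat tau"
  have t_eq: "tau = int t" "t > 0" using tau_pos by (auto simp: t_def)
  let ?r = "\<lambda>i. real_of_int (coprime_count i \<lfloor>s * real i\<rfloor>) - s * real (totient i)"
  have "Vx s = (\<Sum>i\<in>{0<..tau}. (tau div i) * (i * signed_sum (\<lambda>y. of_bool (coprime y i)) \<lfloor>s * i\<rfloor>))"
    unfolding edge_sum_def right_germ_def signed_sum_cmult[symmetric] by (simp add: mult.commute)
  also have "\<dots> = (\<Sum>i=1..t. (int t div int i) * (int i * coprime_count i \<lfloor>s * real i\<rfloor>))"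
    unfolding t_eq(1) coprime_count_def by (rule sum.reindex_bij_witness[of _ int nat]) auto
  finally have "real_of_int (Vx s) = (\<Sum>i=1..t. real (t div i) * real i * coprime_count i \<lfloor>s * real i\<rfloor>)"
    by (simp add: mult.assoc flip: zdiv_int)
  then have "real_of_int (Vx s) - s * width t = (\<Sum>i=1..t. real (t div i) * real i * ?r i)"
    by (simp add: width_def sum_distrib_left sum_subtractf right_diff_distrib ac_simps)
  also have "\<bar>\<dots>\<bar> \<le> (\<Sum>i=1..t. \<bar>real (t div i) * real i * ?r i\<bar>)" by (rule sum_abs)
  also have "\<dots> \<le> (\<Sum>i=1..t. real t * real (card {e. e dvd i}))"
  proof (rule sum_mono)
    fix i assume i_range: "i \<in> {1..t}"
    have "real (t div i) * real i \<le> real t"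
      by (metis div_times_less_eq_dividend of_nat_le_iff of_nat_mult)
    moreover have "\<bar>?r i\<bar> \<le> real (card {e. e dvd i})" using i_range by (intro coprime_count_approx) auto
    ultimately show "\<bar>real (t div i) * real i * ?r i\<bar> \<le> real t * real (card {e. e dvd i})"
      unfolding abs_mult by (intro mult_mono) auto
  qed
  also have "\<dots> = real t * (\<Sum>i=1..t. real (card {e. e dvd i}))" by (simp add: sum_distrib_left)
  also have "\<dots> \<le> real t * (real t * (1 + ln (real t)))"
    using harm_le_ln[OF t_eq(2)] by (intro mult_left_mono order_trans[OF sum_card_divisors_le]) auto
  finally show ?thesis by (simp add: t_def width_error_def power2_eq_square mult.assoc)
qed

lemma Vx_diff_approx: "\<bar>real_of_int (Vx a) - real_of_int (Vx b) - H * (a - b)\<bar> \<le> err"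
proof -
  have "H * (a - b) = a * H - b * H" by (simp add: algebra_simps)
  then show ?thesis using Vx_approx[of a] Vx_approx[of b] by linarith
qed

lemma err_ge: "1 \<le> err" "real_of_int r \<le> err"
proof -
  have tau: "1 \<le> real (nat tau)" using tau_pos by linarith
  then have "2 * real (nat tau) ^ 2 * 1 \<le> err"
    unfolding width_error_def by (intro mult_left_mono) auto
  moreover have "real (nat tau) * 1 \<le> real (nat tau) ^ 2"
    unfolding power2_eq_square using tau by (intro mult_left_mono) auto
  moreover have "real_of_int r \<le> real (nat tau)" using r_nonneg by (simp add: tau_def)
  ultimately show "1 \<le> err" "real_of_int r \<le> err" using tau by linarith+
qed

lemma chord_slope_between:
  assumes "a \<le> b"
  shows "a * real_of_int (Vx b - Vx a) \<le> real_of_int (Vy b - Vy a)"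
    and "real_of_int (Vy b - Vy a) \<le> b * real_of_int (Vx b - Vx a)"
proof -
  let ?E = "\<lambda>i. {y. y \<in> {right_germ a i<..right_germ b i} \<and> coprime y i}"
  have diff: "real_of_int (edge_sum w (right_germ b) - edge_sum w (right_germ a))
      = (\<Sum>i\<in>{0<..tau}. \<Sum>y\<in>?E i. real_of_int (tau div i) * real_of_int (w i y))" for w
    using assms by (subst edge_sum_diff) (auto intro: right_germ_mono)
  have edge: "a * real_of_int i \<le> real_of_int y" "real_of_int y \<le> b * real_of_int i"
    if "y \<in> ?E i" for i y
    using that by (auto simp: right_germ_def le_floor_iff floor_less_iff)
  have mult: "c * (\<Sum>i\<in>{0<..tau}. \<Sum>y\<in>?E i. real_of_int (tau div i) * real_of_int i)
      = (\<Sum>i\<in>{0<..tau}. \<Sum>y\<in>?E i. real_of_int (tau div i) * (c * real_of_int i))" for c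
    by (simp add: sum_distrib_left mult.left_commute)
  show "a * real_of_int (Vx b - Vx a) \<le> real_of_int (Vy b - Vy a)"
    "real_of_int (Vy b - Vy a) \<le> b * real_of_int (Vx b - Vx a)"
    unfolding diff mult by (intro sum_mono mult_left_mono edge; simp add: tau_div_nonneg)+
qed

lemma support_concave: "support b \<le> support a - (b - a) * Vx a"
  using chord_slope_between(2)[of a b] chord_slope_between(1)[of b a]
  by (cases "a \<le> b") (simp_all add: support_def algebra_simps)

lemma support_estimate:
  "\<bar>support s - support s0 + real_of_int (Vx s0) * (s - s0) + H * (s - s0)\<^sup>2 / 2\<bar> \<le> err * \<bar>s - s0\<bar>"
  using support_concave Vx_diff_approx by (rule concave_quadratic_estimate)

lemma depth_set_above_support:
  assumes "(X, Y) \<in> depth_set m"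
  shows "support s + m / tau \<le> real_of_int Y - s * real_of_int X"
proof -
  have "real_of_int m \<le> real_of_int (depth_at s X Y)" using assms by (simp add: depth_set_def)
  then have "real_of_int m \<le> tau * (Y - s * X - support s)"
    using depth_at_bounds(1)[of s X Y] by linarith
  then show ?thesis using tau_pos by (simp add: field_simps)
qed

lemma vertex_near_tangent:
  fixes s s0 :: real
  assumes s_near: "s \<notin> \<rat>" "\<bar>s - s0\<bar> \<le> 2" "H * \<bar>s - s0\<bar> \<le> 2 * (err + r + 1)"
  shows "snd (vertex m s) - s0 * fst (vertex m s) \<le> support s0 + m / tau + 17 * err"
proof -
  obtain X Y where vertex_eq: "vertex m s = (X, Y)" by fastforce
  have X_near: "\<bar>X - Vx s\<bar> \<le> r" and depth_eq: "depth_at s X Y = m"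
    using vertex_near_Vx[OF s_near(1), of m] depth_at_vertex[OF s_near(1), of m] vertex_eq by auto
  have H_nonneg: "0 \<le> H" by (simp add: width_def sum_nonneg)
  have "\<bar>H * (s - s0)\<bar> \<le> 2 * (err + r + 1)" using s_near(3) H_nonneg by (simp add: abs_mult)
  moreover have "\<bar>real_of_int X - Vx s\<bar> \<le> r" using X_near by linarith
  ultimately have "\<bar>real_of_int X - Vx s0\<bar> \<le> 6 * err + 2"
    using Vx_diff_approx[of s s0] err_ge by (smt (verit))
  then have "\<bar>s - s0\<bar> * \<bar>real_of_int X - Vx s0\<bar> \<le> 2 * (6 * err + 2)"
    using s_near(2) err_ge by (intro mult_mono) auto
  then have tilt: "(s - s0) * (real_of_int X - Vx s0) \<le> 12 * err + 4"
    using abs_ge_self[of "(s - s0) * (real_of_int X - Vx s0)"] by (simp add: abs_mult)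
  have "tau * (real_of_int Y - s * X - support s) \<le> m + tau"
    using depth_at_bounds(2)[where s = s and X = X and Y = Y] depth_eq by simp
  then have "real_of_int Y - s * X \<le> support s + m / tau + 1"
    using tau_pos by (simp add: field_simps)
  also have "\<dots> \<le> support s0 - (s - s0) * Vx s0 + m / tau + 1" using support_concave[of s s0] by simp
  finally have "real_of_int Y - s0 * X \<le> support s0 + m / tau + 1 + (s - s0) * (real_of_int X - Vx s0)"
    by (simp add: algebra_simps)
  then show ?thesis using tilt err_ge by (simp add: vertex_eq)
qed

lemma depth_set_hull_near_tangent:
  fixes X s0 :: real
  assumes H_ge: "err + r + 1 \<le> H" and X_near: "\<bar>X - Vx s0\<bar> \<le> 1"
  obtains y where "(X, y) \<in> convex hull (pt ` depth_set m)"
    "y - s0 * X \<le> support s0 + m / tau + 17 * err"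
proof -
  define \<delta> where "\<delta> = (err + r + 1) / H"
  have \<delta>: "0 < \<delta>" "\<delta> \<le> 1" "H * \<delta> = err + r + 1" and H_pos: "0 < H"
    using H_ge err_ge r_nonneg by (auto simp: \<delta>_def)
  obtain s2 where s2_range: "s0 + \<delta> < s2" "s2 < s0 + 2 * \<delta>" "s2 \<notin> \<rat>"
    by (rule exists_irrational_between[of "s0 + \<delta>" "s0 + 2 * \<delta>"]) (use \<delta>(1) in auto)
  obtain s1 where s1_range: "s0 - 2 * \<delta> < s1" "s1 < s0 - \<delta>" "s1 \<notin> \<rat>"
    by (rule exists_irrational_between[of "s0 - 2 * \<delta>" "s0 - \<delta>"]) (use \<delta>(1) in auto)
  have near: "snd (vertex m s) - s0 * fst (vertex m s) \<le> support s0 + m / tau + 17 * err"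
    if "s \<notin> \<rat>" "\<bar>s - s0\<bar> \<le> 2 * \<delta>" for s
  proof (rule vertex_near_tangent[OF that(1)])
    show "\<bar>s - s0\<bar> \<le> 2" using that(2) \<delta>(2) by linarith
    have "H * \<bar>s - s0\<bar> \<le> H * (2 * \<delta>)" using that(2) H_pos by (intro mult_left_mono) auto
    then show "H * \<bar>s - s0\<bar> \<le> 2 * (err + r + 1)" using \<delta>(3) by simp
  qed
  have in_hull: "pt (vertex m s) \<in> convex hull (pt ` depth_set m)" if "s \<notin> \<rat>" for s
    using vertex_in_depth_set[OF that] by (intro hull_inc imageI)
  have "H * \<delta> \<le> H * (s2 - s0)" using s2_range H_pos by (intro mult_left_mono) auto
  moreover have "\<bar>real_of_int (fst (vertex m s2)) - Vx s2\<bar> \<le> r"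
    using vertex_near_Vx[OF s2_range(3), of m] by linarith
  ultimately have right: "X \<le> fst (vertex m s2)"
    using Vx_diff_approx[of s2 s0] X_near \<delta>(3) by linarith
  have "H * (s1 - s0) \<le> H * (- \<delta>)" using s1_range H_pos by (intro mult_left_mono) auto
  moreover have "\<bar>real_of_int (fst (vertex m s1)) - Vx s1\<bar> \<le> r"
    using vertex_near_Vx[OF s1_range(3), of m] by linarith
  ultimately have left: "fst (vertex m s1) \<le> X" using Vx_diff_approx[of s1 s0] X_near \<delta>(3) by simp
  obtain y where "(X, y) \<in> convex hull (pt ` depth_set m)"
    "y - s0 * X \<le> support s0 + m / tau + 17 * err"
    by (rule convex_point_between[OF convex_convex_hull
          in_hull[OF s1_range(3)] in_hull[OF s2_range(3)] left right
          near[OF s1_range(3)] near[OF s2_range(3)]]) (use s1_range s2_range in auto)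
  then show thesis by (rule that)
qed

end

subsection \<open>Comparison with a parabola\<close>

definition parabola :: "real \<Rightarrow> real \<Rightarrow> real \<Rightarrow> real \<Rightarrow> real" where
  "parabola K b c x = x\<^sup>2 / (2 * K) + b * x + c"

definition parabola_support :: "real \<Rightarrow> real \<Rightarrow> real \<Rightarrow> real \<Rightarrow> real" where
  "parabola_support K b c s = c - K * (s - b)\<^sup>2 / 2"

lemma parabola_support_le:
  assumes "0 < K"
  shows "parabola_support K b c s + s * x \<le> parabola K b c x"
proof -
  have "parabola K b c x - (parabola_support K b c s + s * x) = (x - K * (s - b))\<^sup>2 / (2 * K)"
    using assms by (simp add: parabola_def parabola_support_def power2_eq_square field_simps)
  moreover have "0 \<le> (x - K * (s - b))\<^sup>2 / (2 * K)" using assms by simp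
  ultimately show ?thesis by linarith
qed

lemma parabola_support_tangent:
  assumes "0 < K"
  shows "parabola_support K b c (b + x / K) + (b + x / K) * x = parabola K b c x"
  using assms by (simp add: parabola_def parabola_support_def power2_eq_square field_simps)

lemma parabola_support_expand:
  assumes "0 < K"
  shows "parabola_support K b c s
    = parabola_support K b c (b + x / K) - x * (s - (b + x / K)) - K * (s - (b + x / K))\<^sup>2 / 2"
  using assms by (simp add: parabola_support_def power2_eq_square field_simps)

lemma quadratic_lower_bound:
  fixes M D :: real
  assumes "1 \<le> M"
  shows "- 2 * M \<le> M * D\<^sup>2 / 2 - (M + 1) * \<bar>D\<bar>"
proof -
  have "0 \<le> (M * \<bar>D\<bar> - (M + 1))\<^sup>2" by simp
  also have "\<dots> = 2 * M * (M * D\<^sup>2 / 2 - (M + 1) * \<bar>D\<bar>) + (M + 1)\<^sup>2"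
    by (simp add: power2_eq_square algebra_simps)
  finally have "0 \<le> 2 * M * (M * D\<^sup>2 / 2 - (M + 1) * \<bar>D\<bar>) + (M + 1)\<^sup>2" .
  moreover have "(M + 1)\<^sup>2 \<le> (2 * M)\<^sup>2" using assms by (intro power_mono) auto
  ultimately have "2 * M * (- 2 * M) \<le> 2 * M * (M * D\<^sup>2 / 2 - (M + 1) * \<bar>D\<bar>)"
    by (simp add: power2_eq_square)
  then show ?thesis using assms by (subst (asm) mult_le_cancel_left_pos) auto
qed

context strip
begin

definition support_gap :: "real \<Rightarrow> real \<Rightarrow> real \<Rightarrow> int \<Rightarrow> real \<Rightarrow> real" where
  "support_gap K b c tX s = support s - s * tX - parabola_support K b c s"

lemma support_gap_estimate:
  fixes K b c x :: real
  assumes "0 < K"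
  defines "s0 \<equiv> b + x / K"
  defines "tX \<equiv> \<lfloor>x - Vx s0\<rfloor>"
  shows "\<bar>support_gap K b c tX s - support_gap K b c tX s0 - (K - H) * (s - s0)\<^sup>2 / 2\<bar>
    \<le> (err + 1) * \<bar>s - s0\<bar>"
proof -
  have "\<bar>x - Vx s0 - tX\<bar> * \<bar>s - s0\<bar> \<le> 1 * \<bar>s - s0\<bar>"
    unfolding tX_def by (intro mult_right_mono) linarith+
  then have round: "\<bar>(x - Vx s0 - tX) * (s - s0)\<bar> \<le> \<bar>s - s0\<bar>" by (simp add: abs_mult)
  have gap_diff: "support_gap K b c tX s - support_gap K b c tX s0 - (K - H) * (s - s0)\<^sup>2 / 2
      = (support s - support s0 + Vx s0 * (s - s0) + H * (s - s0)\<^sup>2 / 2) + (x - Vx s0 - tX) * (s - s0)"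
    unfolding support_gap_def parabola_support_expand[OF assms(1), of b c s x] s0_def[symmetric]
    by (simp add: field_simps)
  show ?thesis unfolding gap_diff distrib_right mult_1
    using abs_triangle_ineq add_mono[OF support_estimate[of s s0] round] by (rule order_trans)
qed

lemma support_gap_ge:
  fixes K b c x :: real
  assumes "0 < K" and K_ge: "err \<le> K - H"
  defines "s0 \<equiv> b + x / K"
  defines "tX \<equiv> \<lfloor>x - Vx s0\<rfloor>"
  shows "support_gap K b c tX s0 - 2 * err \<le> support_gap K b c tX s"
proof -
  have "err * (s - s0)\<^sup>2 / 2 \<le> (K - H) * (s - s0)\<^sup>2 / 2"
    using K_ge by (intro divide_right_mono mult_right_mono) auto
  then show ?thesis
    using support_gap_estimate[OF assms(1), where b = b and c = c and x = x and s = s]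
      quadratic_lower_bound[OF err_ge(1), of "s - s0"] unfolding s0_def tX_def by linarith
qed

lemma support_gap_le:
  fixes K b c x :: real
  assumes "0 < K" and K_le: "err \<le> H - K"
  defines "s0 \<equiv> b + x / K"
  defines "tX \<equiv> \<lfloor>x - Vx s0\<rfloor>"
  shows "support_gap K b c tX s \<le> support_gap K b c tX s0 + 2 * err"
proof -
  have "err * (s - s0)\<^sup>2 / 2 \<le> (H - K) * (s - s0)\<^sup>2 / 2"
    using K_le by (intro divide_right_mono mult_right_mono) auto
  moreover have "(H - K) * (s - s0)\<^sup>2 / 2 = - ((K - H) * (s - s0)\<^sup>2 / 2)"
    by (simp add: left_diff_distrib diff_divide_distrib)
  ultimately show ?thesis
    using support_gap_estimate[OF assms(1), where b = b and c = c and x = x and s = s]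
      quadratic_lower_bound[OF err_ge(1), of "s - s0"] unfolding s0_def tX_def by linarith
qed

end

definition peeled_hull :: "nat \<Rightarrow> (real \<Rightarrow> real) \<Rightarrow> nat \<Rightarrow> (real \<times> real) set" where
  "peeled_hull n f m = convex hull ((peel ^^ m) (grid_epi n f))"

lemma grid_epi_1: "grid_epi 1 f = pt ` {p. f (real_of_int (fst p)) \<le> real_of_int (snd p)}"
  unfolding grid_epi_def grid_def by (auto simp: image_iff)

lemma grid_epi_rescale:
  assumes "n > 0"
  shows "grid_epi n f = (*\<^sub>R) (1 / real n) ` grid_epi 1 (\<lambda>x. real n * f (x / real n))"
proof -
  have "f (real_of_int i / n) \<le> real_of_int j / n \<longleftrightarrow> n * f (real_of_int i / n) \<le> real_of_int j"
    for i j :: int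
    using assms by (simp add: le_divide_eq mult.commute)
  then have "grid_epi n f = (\<lambda>p. (1 / real n) *\<^sub>R pt p) `
      {p. real n * f (real_of_int (fst p) / real n) \<le> real_of_int (snd p)}"
    using assms unfolding grid_epi_def grid_def by (auto simp: image_iff)
  then show ?thesis unfolding grid_epi_1 image_image .
qed

lemma mem_peeled_hull_rescale:
  assumes "n > 0"
  shows "(x, y) \<in> peeled_hull n f m
    \<longleftrightarrow> (real n * x, real n * y) \<in> peeled_hull 1 (\<lambda>x. real n * f (x / real n)) m"
proof -
  have inj: "inj ((*\<^sub>R) (1 / real n) :: real \<times> real \<Rightarrow> _)" using assms by (auto simp: inj_def)
  have "peeled_hull n f m = (*\<^sub>R) (1 / real n) ` peeled_hull 1 (\<lambda>x. real n * f (x / real n)) m"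
    using assms unfolding peeled_hull_def grid_epi_rescale[OF assms]
    by (simp add: peel_pow_scaleR convex_hull_scaling)
  moreover have "(x, y) = (1 / real n) *\<^sub>R (real n * x, real n * y)" using assms by simp
  ultimately show ?thesis by (metis inj inj_image_mem_iff)
qed

context strip
begin

lemma peel_pow_depth_set_translate:
  "(peel ^^ m) ((+) v ` pt ` depth_set 0) = (+) v ` pt ` depth_set (int m)"
  by (simp add: peel_pow_translation peel_pow_depth_set)

lemma translated_depth_set_subset_parabola_epi:
  fixes K b c x :: real
  assumes K_pos: "0 < K" and K_ge: "err \<le> K - H"
  defines "tX \<equiv> \<lfloor>x - Vx (b + x / K)\<rfloor>"
  assumes tY_ge: "2 * err - support_gap K b c tX (b + x / K) \<le> tY"
  shows "(+) (pt (tX, tY)) ` pt ` depth_set 0 \<subseteq> grid_epi 1 (parabola K b c)"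
proof -
  have above: "parabola K b c (X + tX) \<le> Y + tY" if in_depth_set: "(X, Y) \<in> depth_set 0" for X Y
  proof -
    define s where "s = b + real_of_int (X + tX) / K"
    have "parabola K b c (X + tX) = parabola_support K b c s + s * (X + tX)"
      unfolding s_def by (rule parabola_support_tangent[OF K_pos, symmetric])
    also have "\<dots> = support s + s * X - support_gap K b c tX s"
      by (simp add: support_gap_def algebra_simps)
    also have "\<dots> \<le> support s + s * X + tY"
      using support_gap_ge[OF K_pos K_ge, where b = b and c = c and x = x and s = s] tY_ge
      unfolding tX_def by linarith
    also have "\<dots> \<le> Y + tY" using depth_set_above_support[OF in_depth_set, of s] by simp
    finally show ?thesis by simp
  qed
  show ?thesis
    unfolding grid_epi_1 image_image
  proof (rule image_subsetI)
    fix p assume "p \<in> depth_set 0"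
    then show "pt (tX, tY) + pt p \<in> pt ` {p. parabola K b c (real_of_int (fst p)) \<le> real_of_int (snd p)}"
      using above[of "fst p" "snd p"] by (intro image_eqI[of _ _ "(fst p + tX, snd p + tY)"]) auto
  qed
qed

lemma parabola_epi_subset_translated_depth_set:
  fixes K b c x :: real
  assumes K_pos: "0 < K" and K_le: "err \<le> H - K"
  defines "tX \<equiv> \<lfloor>x - Vx (b + x / K)\<rfloor>"
  assumes tY_le: "tY \<le> - support_gap K b c tX (b + x / K) - 2 * err - 1"
  shows "grid_epi 1 (parabola K b c) \<subseteq> (+) (pt (tX, tY)) ` pt ` depth_set 0"
proof -
  have deep: "(X - tX, Y - tY) \<in> depth_set 0"
    if in_epi: "parabola K b c (real_of_int X) \<le> real_of_int Y" for X Y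
  proof -
    have "0 \<le> depth_at s (X - tX) (Y - tY)" for s
    proof -
      have "parabola_support K b c s + s * X \<le> Y"
        using parabola_support_le[OF K_pos, of b c s X] in_epi by simp
      moreover have "support_gap K b c tX s + tY + 1 \<le> 0"
        using support_gap_le[OF K_pos K_le, where b = b and c = c and x = x and s = s] tY_le
        unfolding tX_def by linarith
      ultimately have "1 \<le> real_of_int (Y - tY) - s * real_of_int (X - tX) - support s"
        by (simp add: support_gap_def algebra_simps)
      then have "real_of_int tau * 1 \<le> tau * (real_of_int (Y - tY) - s * real_of_int (X - tX) - support s)"
        using tau_pos by (intro mult_left_mono) auto
      then have "0 \<le> real_of_int (depth_at s (X - tX) (Y - tY))"
        using depth_at_bounds(2)[where s = s and X = "X - tX" and Y = "Y - tY"] by linarith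
      then show ?thesis by simp
    qed
    then show ?thesis by (simp add: depth_set_def)
  qed
  show ?thesis
    unfolding grid_epi_1 image_image
  proof (rule image_subsetI)
    fix p assume "p \<in> {p. parabola K b c (real_of_int (fst p)) \<le> real_of_int (snd p)}"
    then show "pt p \<in> (\<lambda>p. pt (tX, tY) + pt p) ` depth_set 0"
      using deep[of "fst p" "snd p"] by (intro image_eqI[of _ _ "(fst p - tX, snd p - tY)"]) auto
  qed
qed

lemma peeled_hull_parabola_le:
  assumes K_ge: "err \<le> K - H" and H_ge: "err + r + 1 \<le> H"
  shows "\<exists>y. (x, y) \<in> peeled_hull 1 (parabola K b c) m \<and> y \<le> parabola K b c x + m / tau + 20 * err"
proof -
  have K_pos: "0 < K" using K_ge H_ge err_ge r_nonneg by linarith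
  define s0 where "s0 = b + x / K"
  define tX where "tX = \<lfloor>x - Vx s0\<rfloor>"
  define g where "g = support_gap K b c tX s0"
  define tY where "tY = \<lceil>2 * err - g\<rceil>"
  have inside: "(+) (pt (tX, tY)) ` pt ` depth_set 0 \<subseteq> grid_epi 1 (parabola K b c)"
    using translated_depth_set_subset_parabola_epi[OF K_pos K_ge,
        where b = b and c = c and x = x and tY = tY]
    by (simp add: tX_def s0_def tY_def g_def)
  have "\<bar>x - tX - Vx s0\<bar> \<le> 1" unfolding tX_def by linarith
  then obtain y where y_low: "(x - tX, y) \<in> convex hull (pt ` depth_set m)"
    "y - s0 * (x - tX) \<le> support s0 + m / tau + 17 * err"
    using depth_set_hull_near_tangent[OF H_ge, where X = "x - tX" and m = m] by auto
  have "(x, y + tY) = pt (tX, tY) + (x - tX, y)" by simp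
  then have "(x, y + tY) \<in> convex hull ((+) (pt (tX, tY)) ` pt ` depth_set m)"
    unfolding convex_hull_translation using y_low(1) by (rule image_eqI)
  also have "\<dots> \<subseteq> peeled_hull 1 (parabola K b c) m"
    unfolding peeled_hull_def peel_pow_depth_set_translate[symmetric]
    using inside by (intro hull_mono peel_pow_mono)
  finally have "(x, y + tY) \<in> peeled_hull 1 (parabola K b c) m" .
  moreover have "y + tY \<le> parabola K b c x + m / tau + 20 * err"
  proof -
    have "y + tY \<le> parabola_support K b c s0 + s0 * x + (g + tY) + m / tau + 17 * err"
      using y_low(2) by (simp add: g_def support_gap_def algebra_simps)
    moreover have "g + tY \<le> 2 * err + 1" unfolding tY_def by linarith
    moreover have "parabola_support K b c s0 + s0 * x = parabola K b c x"
      unfolding s0_def by (rule parabola_support_tangent[OF K_pos])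
    ultimately show ?thesis using err_ge(1) by linarith
  qed
  ultimately show ?thesis by blast
qed

lemma peeled_hull_parabola_ge:
  assumes K_pos: "0 < K" and K_le: "err \<le> H - K"
    and y_in: "(x, y) \<in> peeled_hull 1 (parabola K b c) m"
  shows "parabola K b c x + m / tau - 4 * err \<le> y"
proof -
  define s0 where "s0 = b + x / K"
  define tX where "tX = \<lfloor>x - Vx s0\<rfloor>"
  define g where "g = support_gap K b c tX s0"
  define tY where "tY = \<lfloor>- g - 2 * err - 1\<rfloor>"
  have "of_int tY \<le> - g - 2 * err - 1" unfolding tY_def by linarith
  then have outside: "grid_epi 1 (parabola K b c) \<subseteq> (+) (pt (tX, tY)) ` pt ` depth_set 0"
    using parabola_epi_subset_translated_depth_set[OF K_pos K_le,
        where b = b and c = c and x = x and tY = tY]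
    by (simp add: tX_def s0_def g_def)
  let ?B = "support s0 + m / tau + tY - s0 * tX"
  have "peeled_hull 1 (parabola K b c) m \<subseteq> convex hull ((+) (pt (tX, tY)) ` pt ` depth_set m)"
    unfolding peeled_hull_def peel_pow_depth_set_translate[symmetric]
    using outside by (intro hull_mono peel_pow_mono)
  also have "\<dots> \<subseteq> {q. (- s0, 1) \<bullet> q \<ge> ?B}"
  proof (intro hull_minimal convex_halfspace_ge, unfold image_image, rule image_subsetI)
    fix p assume "p \<in> depth_set m"
    then show "pt (tX, tY) + pt p \<in> {q. (- s0, 1) \<bullet> q \<ge> ?B}"
      using depth_set_above_support[of "fst p" "snd p" m s0] by (simp add: algebra_simps)
  qed
  finally have "?B \<le> (- s0, 1) \<bullet> (x, y)" using y_in by blast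
  then have "parabola_support K b c s0 + s0 * x + (g + tY) + m / tau \<le> y"
    by (simp add: g_def support_gap_def algebra_simps)
  moreover have "- 2 * err - 2 \<le> g + tY" unfolding tY_def by linarith
  moreover have "parabola_support K b c s0 + s0 * x = parabola K b c x"
    unfolding s0_def by (rule parabola_support_tangent[OF K_pos])
  ultimately show ?thesis using err_ge(1) by linarith
qed

end

lemma parabola_rescale:
  assumes "n > 0" "a > 0"
  shows "real n * (a / 2 * (x / real n)\<^sup>2 + b * (x / real n) + c) = parabola (real n / a) b (c * real n) x"
  using assms by (simp add: parabola_def power2_eq_square field_simps)

lemma grid_polygon_parabola_bounds:
  fixes a b c x :: real and n m r1 r2 :: nat
  defines "f \<equiv> \<lambda>x. a / 2 * x\<^sup>2 + b * x + c" and "t1 \<equiv> 2 * r1 + 1" and "t2 \<equiv> 2 * r2 + 1"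
  assumes n_pos: "n > 0" and a_pos: "a > 0"
    and inner: "width_error t1 \<le> n / a - width t1" "width_error t1 + r1 + 1 \<le> width t1"
    and outer: "width_error t2 \<le> width t2 - n / a"
  shows "grid_polygon n f m x \<le> f x + (m / t1 + 20 * width_error t1) / n"
    and "f x + (m / t2 - 4 * width_error t2) / n \<le> grid_polygon n f m x"
proof -
  interpret s1: strip "int r1" by unfold_locales simp
  interpret s2: strip "int r2" by unfold_locales simp
  have tau1: "s1.tau = int t1" and tau2: "s2.tau = int t2"
    by (simp_all add: s1.tau_def s2.tau_def t1_def t2_def)
  let ?F = "parabola (n / a) b (c * n)"
  have F_eq: "(\<lambda>x. n * f (x / n)) = ?F"
    unfolding f_def using parabola_rescale[OF n_pos a_pos] by blast
  have F_scaled: "?F (n * x) = n * f x" using fun_cong[OF F_eq, of "n * x"] n_pos by simp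
  define S where "S = {y. (x, y) \<in> peeled_hull n f m}"
  have mem_S: "y \<in> S \<longleftrightarrow> (n * x, n * y) \<in> peeled_hull 1 ?F m" for y :: real
    using mem_peeled_hull_rescale[OF n_pos, of x y f m] by (simp add: S_def F_eq)
  obtain y where y_low: "(n * x, y) \<in> peeled_hull 1 ?F m" "y \<le> n * f x + (m / t1 + 20 * width_error t1)"
    using s1.peeled_hull_parabola_le[of "n / a" "n * x" b "c * n" m] inner
    unfolding tau1 F_scaled by (auto simp: add.assoc)
  have y_S: "y / n \<in> S" using y_low(1) n_pos mem_S[of "y / n"] by simp
  have y_le: "y / n \<le> f x + (m / t1 + 20 * width_error t1) / n"
    using divide_right_mono[OF y_low(2), of n] n_pos by (simp add: add_divide_distrib)
  have lower: "f x + (m / t2 - 4 * width_error t2) / n \<le> z" if "z \<in> S" for z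
  proof -
    have "n * f x + (m / t2 - 4 * width_error t2) \<le> n * z"
      using s2.peeled_hull_parabola_ge[of "n / a" "n * x" "n * z" b "c * n" m] outer that n_pos a_pos
      unfolding tau2 F_scaled by (simp add: mem_S)
    from divide_right_mono[OF this, of n] show ?thesis using n_pos by (simp add: add_divide_distrib)
  qed
  have grid_polygon: "grid_polygon n f m x = Inf S"
    by (simp add: grid_polygon_def S_def peeled_hull_def)
  have "Inf S \<le> y / n" using y_S lower by (intro cInf_lower) (auto simp: bdd_below_def)
  then show "grid_polygon n f m x \<le> f x + (m / t1 + 20 * width_error t1) / n"
    unfolding grid_polygon using y_le by linarith
  show "f x + (m / t2 - 4 * width_error t2) / n \<le> grid_polygon n f m x"
    unfolding grid_polygon using y_S lower by (intro cInf_greatest) auto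
qed

subsection \<open>Choice of the period\<close>

definition near_period :: "real \<Rightarrow> real \<Rightarrow> nat \<Rightarrow> bool" where
  "near_period C k t \<longleftrightarrow> width_error t \<le> C * k\<^sup>2 * ln k \<and> \<bar>1 / real t - 1 / k\<bar> \<le> C * ln k / k\<^sup>2"

definition inner_period :: "real \<Rightarrow> real \<Rightarrow> nat \<Rightarrow> bool" where
  "inner_period C k t \<longleftrightarrow> near_period C k t
    \<and> width_error t \<le> (k / c_g) ^ 3 - width t \<and> width_error t + real t \<le> width t"

definition outer_period :: "real \<Rightarrow> real \<Rightarrow> nat \<Rightarrow> bool" where
  "outer_period C k t \<longleftrightarrow> near_period C k t \<and> width_error t \<le> width t - (k / c_g) ^ 3"

lemma width_error_le:
  assumes "0 < t" "real t \<le> 2 * k" "1 \<le> ln k"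
  shows "width_error t \<le> 24 * k\<^sup>2 * ln k"
proof -
  have k_pos: "0 < k" using assms by linarith
  have "ln (real t) \<le> ln (2 * k)" using assms k_pos by simp
  also have "\<dots> \<le> 1 + ln k" using k_pos ln_le_minus_one[of "2::real"] by (simp add: ln_mult_pos)
  finally have "1 + ln (real t) \<le> 3 * ln k" using assms(3) by linarith
  moreover have "real t ^ 2 \<le> (2 * k)\<^sup>2" using assms by (intro power_mono) auto
  ultimately have "2 * real t ^ 2 * (1 + ln (real t)) \<le> 2 * (2 * k)\<^sup>2 * (3 * ln k)"
    using assms by (intro mult_mono) auto
  then show ?thesis by (simp add: width_error_def power2_eq_square)
qed

lemma near_periodI:
  assumes t_near: "k / 2 \<le> real t" "real t \<le> 2 * k" "\<bar>real t - k\<bar> \<le> B * ln k"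
    and k_large: "1 \<le> ln k" "0 < k"
  shows "near_period (24 + 2 * B) k t"
  unfolding near_period_def
proof
  have t_pos: "0 < real t" using t_near k_large by linarith
  have k_ge: "1 \<le> k" using k_large ln_ge_zero_iff[of k] by linarith
  have B_nonneg: "0 \<le> B" using t_near(3) k_large(1) by (smt (verit) mult_neg_pos)
  have "width_error t \<le> 24 * (k\<^sup>2 * ln k)"
    using width_error_le[OF _ t_near(2) k_large(1)] t_pos by simp
  also have "\<dots> \<le> (24 + 2 * B) * (k\<^sup>2 * ln k)" using B_nonneg k_ge by (intro mult_right_mono) auto
  finally show "width_error t \<le> (24 + 2 * B) * k\<^sup>2 * ln k" by simp
  have "\<bar>1 / real t - 1 / k\<bar> = \<bar>real t - k\<bar> / (real t * k)"
    using t_pos k_large by (simp add: divide_simps abs_minus_commute abs_mult)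
  also have "\<dots> \<le> (B * ln k) / (k / 2 * k)"
    using t_near t_pos k_large by (intro frac_le mult_right_mono) auto
  also have "\<dots> = 2 * B * ln k / k\<^sup>2" by (simp add: power2_eq_square)
  also have "\<dots> \<le> (24 + 2 * B) * ln k / k\<^sup>2"
    using k_ge by (intro divide_right_mono mult_right_mono) auto
  finally show "\<bar>1 / real t - 1 / k\<bar> \<le> (24 + 2 * B) * ln k / k\<^sup>2" .
qed

lemma cube_diff_ge:
  fixes u v :: real
  assumes "0 \<le> u" "u \<le> v"
  shows "(v - u) * v\<^sup>2 \<le> v ^ 3 - u ^ 3" "(v - u) * u\<^sup>2 \<le> v ^ 3 - u ^ 3"
proof -
  have "v ^ 3 - u ^ 3 = (v - u) * (v\<^sup>2 + v * u + u\<^sup>2)"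
    by (simp add: power2_eq_square power3_eq_cube algebra_simps)
  moreover have "v\<^sup>2 \<le> v\<^sup>2 + v * u + u\<^sup>2" "u\<^sup>2 \<le> v\<^sup>2 + v * u + u\<^sup>2" using assms by auto
  ultimately show "(v - u) * v\<^sup>2 \<le> v ^ 3 - u ^ 3" "(v - u) * u\<^sup>2 \<le> v ^ 3 - u ^ 3"
    using assms by (auto intro!: mult_left_mono)
qed

text \<open>
  Moving \<open>t\<close> away from \<open>k\<close> by \<open>96 * c_g ^ 3 * ln k\<close> changes \<open>(t / c_g) ^ 3\<close> by at
  least four times \<open>width_error t\<close>, of which three are lost to \<open>width_near_cube\<close>.
\<close>

lemma width_gap_below:
  assumes t_far: "0 < t" "real t \<le> k - 96 * c_g ^ 3 * ln k" and k_large: "1 \<le> ln k" "0 < k"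
  shows "width_error t \<le> (k / c_g) ^ 3 - width t"
proof -
  have c_pos: "0 < c_g ^ 3" using c_g_pos by simp
  have t_le: "real t \<le> k" using t_far(2) c_pos k_large by (smt (verit) mult_nonneg_nonneg)
  have "96 * c_g ^ 3 * ln k * k\<^sup>2 \<le> (k - real t) * k\<^sup>2" using t_far by (intro mult_right_mono) auto
  also have "\<dots> \<le> k ^ 3 - real t ^ 3" using t_le by (intro cube_diff_ge) auto
  finally have "4 * (24 * k\<^sup>2 * ln k) \<le> (k / c_g) ^ 3 - (real t / c_g) ^ 3"
    using c_pos by (simp add: field_simps)
  moreover have "width_error t \<le> 24 * k\<^sup>2 * ln k"
    using t_far(1) t_le k_large by (intro width_error_le) auto
  ultimately show ?thesis using width_near_cube[OF t_far(1)] by linarith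
qed

lemma width_gap_above:
  assumes t_far: "k + 96 * c_g ^ 3 * ln k \<le> real t" "real t \<le> 2 * k" and k_large: "1 \<le> ln k" "0 < k"
  shows "width_error t \<le> width t - (k / c_g) ^ 3"
proof -
  have c_pos: "0 < c_g ^ 3" using c_g_pos by simp
  have t_ge: "k \<le> real t" using t_far(1) c_pos k_large by (smt (verit) mult_nonneg_nonneg)
  then have t_pos: "0 < t" using k_large by (metis of_nat_0_less_iff order_less_le_trans)
  have "96 * c_g ^ 3 * ln k * k\<^sup>2 \<le> (real t - k) * k\<^sup>2" using t_far by (intro mult_right_mono) auto
  also have "\<dots> \<le> real t ^ 3 - k ^ 3" using t_ge k_large by (intro cube_diff_ge) auto
  finally have "4 * (24 * k\<^sup>2 * ln k) \<le> (real t / c_g) ^ 3 - (k / c_g) ^ 3"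
    using c_pos by (simp add: field_simps)
  moreover have "width_error t \<le> 24 * k\<^sup>2 * ln k"
    using t_pos t_far k_large by (intro width_error_le) auto
  ultimately show ?thesis using width_near_cube[OF t_pos] by linarith
qed

lemma width_error_plus_le_width:
  assumes t_range: "k / 2 \<le> real t" "real t \<le> k" and k_large: "1 \<le> ln k" "0 < k"
    and cube: "96 * (k\<^sup>2 * ln k) + k \<le> 1 / (8 * c_g ^ 3) * k ^ 3"
  shows "width_error t + real t \<le> width t"
proof -
  have t_pos: "0 < t" using t_range k_large by (cases t) auto
  have "1 / (8 * c_g ^ 3) * k ^ 3 = (k / 2 / c_g) ^ 3" by (simp add: field_simps)
  also have "\<dots> \<le> (real t / c_g) ^ 3"
    using t_range k_large c_g_pos by (intro power_mono divide_right_mono) auto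
  finally have "96 * (k\<^sup>2 * ln k) + k - 3 * width_error t \<le> width t"
    using cube width_near_cube[OF t_pos] by linarith
  moreover have "width_error t \<le> 24 * k\<^sup>2 * ln k" using t_range t_pos k_large by (intro width_error_le) auto
  ultimately show ?thesis using t_range by linarith
qed

lemma eventually_inner_period:
  "\<forall>\<^sub>F k in at_top. \<exists>r. inner_period (28 + 192 * c_g ^ 3) k (2 * r + 1)"
proof -
  define B where "B = 96 * c_g ^ 3 + 2"
  define q where "q = 1 / (8 * c_g ^ 3)"
  have q_pos: "0 < q" using c_g_pos by (simp add: q_def)
  have "0 < B" using c_g_pos by (simp add: B_def add_pos_pos)
  then have "\<forall>\<^sub>F k in at_top. B * ln k \<le> k / 2" by real_asymp
  moreover have "\<forall>\<^sub>F k::real in at_top. 1 \<le> ln k" "\<forall>\<^sub>F k::real in at_top. 4 \<le> k" by - real_asymp+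
  moreover have "\<forall>\<^sub>F k::real in at_top. 96 * (k\<^sup>2 * ln k) + k \<le> q * k ^ 3"
    using q_pos by real_asymp
  ultimately show ?thesis
  proof eventually_elim
    case (elim k)
    define d where "d = 96 * c_g ^ 3 * ln k"
    define r where "r = nat \<lfloor>(k - d - 1) / 2\<rfloor>"
    define t where "t = 2 * r + 1"
    have gap: "0 \<le> d" "d + 2 \<le> B * ln k"
      using elim(2) c_g_pos by (simp_all add: d_def B_def distrib_right)
    have "0 \<le> (k - d - 1) / 2" using elim(1) gap by simp
    then have "real r \<le> (k - d - 1) / 2" "(k - d - 1) / 2 < real r + 1"
      unfolding r_def by linarith+
    then have t_range: "real t \<le> k - d" "k - d - 2 < real t" by (simp_all add: t_def)
    have t_ge: "k / 2 \<le> real t" using t_range elim(1) gap by linarith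
    have "near_period (24 + 2 * B) k t"
      using t_range t_ge elim gap by (intro near_periodI) linarith+
    then have "near_period (28 + 192 * c_g ^ 3) k t" by (simp add: B_def)
    moreover have "width_error t \<le> (k / c_g) ^ 3 - width t"
      using t_range(1) elim by (intro width_gap_below) (auto simp: t_def d_def)
    moreover have "width_error t + real t \<le> width t"
      using t_range(1) t_ge elim gap unfolding q_def by (intro width_error_plus_le_width[where k = k]) linarith+
    ultimately show ?case unfolding inner_period_def t_def by blast
  qed
qed

lemma eventually_outer_period:
  "\<forall>\<^sub>F k in at_top. \<exists>r. outer_period (28 + 192 * c_g ^ 3) k (2 * r + 1)"
proof -
  define B where "B = 96 * c_g ^ 3 + 2"
  have "0 < B" using c_g_pos by (simp add: B_def add_pos_pos)
  then have "\<forall>\<^sub>F k in at_top. B * ln k \<le> k / 2" by real_asymp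
  moreover have "\<forall>\<^sub>F k::real in at_top. 1 \<le> ln k" "\<forall>\<^sub>F k::real in at_top. 4 \<le> k" by - real_asymp+
  ultimately show ?thesis
  proof eventually_elim
    case (elim k)
    define d where "d = 96 * c_g ^ 3 * ln k"
    define r where "r = nat \<lceil>(k + d - 1) / 2\<rceil>"
    define t where "t = 2 * r + 1"
    have gap: "0 \<le> d" "d + 2 \<le> B * ln k"
      using elim(2) c_g_pos by (simp_all add: d_def B_def distrib_right)
    have "0 \<le> (k + d - 1) / 2" using elim(3) gap by simp
    then have "(k + d - 1) / 2 \<le> real r" "real r < (k + d - 1) / 2 + 1"
      unfolding r_def by linarith+
    then have t_range: "k + d \<le> real t" "real t < k + d + 2" by (simp_all add: t_def field_simps)
    have t_le: "real t \<le> 2 * k" using t_range elim(1,3) gap by linarith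
    have "near_period (24 + 2 * B) k t"
      using t_range t_le elim gap by (intro near_periodI) linarith+
    then have "near_period (28 + 192 * c_g ^ 3) k t" by (simp add: B_def)
    moreover have "width_error t \<le> width t - (k / c_g) ^ 3"
      using t_range(1) t_le elim by (intro width_gap_above) (auto simp: d_def)
    ultimately show ?case unfolding outer_period_def t_def by blast
  qed
qed

subsection \<open>The parabola theorem\<close>

lemma acsf_graph_flow_parabola:
  assumes "a > 0"
  shows "acsf_graph_flow (\<lambda>t x. a / 2 * x\<^sup>2 + b * x + c + t * a powr (1/3)) (\<lambda>x. a / 2 * x\<^sup>2 + b * x + c)"
  unfolding acsf_graph_flow_def
proof (intro conjI allI impI)
  fix t x :: real assume "0 \<le> t"
  let ?u = "\<lambda>t x. a / 2 * x\<^sup>2 + b * x + c + t * a powr (1/3)"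
  have deriv_x: "((\<lambda>z. ?u t z) has_real_derivative a * y + b) (at y)" for y
    by (auto intro!: derivative_eq_intros simp: field_simps)
  have "deriv (\<lambda>z. ?u t z) = (\<lambda>y. a * y + b)" using deriv_x by (auto intro!: DERIV_imp_deriv)
  then have deriv_xx: "((\<lambda>y. deriv (\<lambda>z. ?u t z) y) has_real_derivative a) (at x)"
    by (auto intro!: derivative_eq_intros)
  have deriv_t: "((\<lambda>s. ?u s x) has_real_derivative a powr (1/3)) (at t within {0..})"
    by (auto intro!: derivative_eq_intros)
  have differentiable: "\<forall>y. (\<lambda>z. ?u t z) differentiable (at y)"
    using deriv_x real_differentiable_def by blast
  let ?q = "1 + (a * x + b)\<^sup>2"
  have q_pos: "0 < ?q" by (simp add: add_pos_nonneg)
  have "a powr (1/3) / sqrt ?q = (a / ?q powr (3/2)) powr (1/3)"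
    using q_pos assms by (simp add: powr_divide powr_powr powr_half_sqrt)
  also have "\<dots> = root 3 (a / ?q powr (3/2))" using q_pos assms by (simp add: root_powr_inverse)
  finally have speed: "a powr (1/3) / sqrt ?q = root 3 (a / ?q powr (3/2))" .
  show "\<exists>ut ux uxx. ((\<lambda>s. ?u s x) has_real_derivative ut) (at t within {0..}) \<and>
      (\<forall>y. (\<lambda>z. ?u t z) differentiable (at y)) \<and>
      ((\<lambda>y. ?u t y) has_real_derivative ux) (at x) \<and>
      ((\<lambda>y. deriv (\<lambda>z. ?u t z) y) has_real_derivative uxx) (at x) \<and>
      ut / sqrt (1 + ux\<^sup>2) = root 3 (uxx / (1 + ux\<^sup>2) powr (3 / 2))"
    using deriv_t differentiable deriv_x[of x] deriv_xx speed by blast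
qed simp

lemma steps_over_period_bounds:
  assumes M_steps: "0 \<le> M" "m = nat \<lfloor>M\<rfloor>" and near: "near_period C k t" and t_pos: "0 < t"
  shows "real m / real t + 20 * width_error t \<le> M / k + (M * (C * ln k / k\<^sup>2) + 20 * (C * k\<^sup>2 * ln k))"
    and "M / k - (M * (C * ln k / k\<^sup>2) + 20 * (C * k\<^sup>2 * ln k)) \<le> real m / real t - 4 * width_error t"
proof -
  let ?\<epsilon> = "C * ln k / k\<^sup>2"
  have inv: "1 / k - ?\<epsilon> \<le> 1 / real t" "1 / real t \<le> 1 / k + ?\<epsilon>"
    and err: "width_error t \<le> C * k\<^sup>2 * ln k" using near by (auto simp: near_period_def abs_le_iff)
  have m_bounds: "real m \<le> M" "M - 1 \<le> real m" using M_steps by auto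
  have "1 \<le> real t ^ 2 * (1 + ln (real t))"
    using t_pos mult_mono[of 1 "real t ^ 2" 1 "1 + ln (real t)"] by (simp add: one_le_power)
  then have err_ge: "1 \<le> width_error t" by (simp add: width_error_def)
  have "real m / real t \<le> M * (1 / real t)" using m_bounds by (simp add: divide_right_mono)
  also have "\<dots> \<le> M * (1 / k + ?\<epsilon>)" using inv M_steps by (intro mult_left_mono) auto
  also have "\<dots> = M / k + M * ?\<epsilon>" by (simp add: distrib_left)
  finally show "real m / real t + 20 * width_error t \<le> M / k + (M * ?\<epsilon> + 20 * (C * k\<^sup>2 * ln k))"
    using err by linarith
  have "M / k - M * ?\<epsilon> = M * (1 / k - ?\<epsilon>)" by (simp add: right_diff_distrib)
  also have "\<dots> \<le> M * (1 / real t)" using inv M_steps by (intro mult_left_mono) auto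
  also have "\<dots> = (M - 1) / real t + 1 / real t" by (simp add: diff_divide_distrib)
  also have "\<dots> \<le> real m / real t + 1"
    using m_bounds t_pos by (intro add_mono divide_right_mono) auto
  finally show "M / k - (M * ?\<epsilon> + 20 * (C * k\<^sup>2 * ln k)) \<le> real m / real t - 4 * width_error t"
    using err err_ge by linarith
qed

lemma grid_polygon_parabola_near:
  fixes a b c T x k :: real and n r1 r2 :: nat
  defines "f \<equiv> \<lambda>x. a / 2 * x\<^sup>2 + b * x + c" and "M \<equiv> c_g * T * real n powr (4/3)"
  assumes n_pos: "n > 0" and a_pos: "a > 0" and T_pos: "T > 0"
    and k_eq: "k = c_g * root 3 (real n / a)"
    and inner: "inner_period C k (2 * r1 + 1)" and outer: "outer_period C k (2 * r2 + 1)"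
  shows "\<bar>grid_polygon n f (nat \<lfloor>M\<rfloor>) x - (f x + M / k / n)\<bar>
    \<le> (M * (C * ln k / k\<^sup>2) + 20 * (C * k\<^sup>2 * ln k)) / n"
proof -
  have cube: "(k / c_g) ^ 3 = n / a"
    using k_eq n_pos a_pos c_g_pos by (simp add: real_root_pow_pos2)
  have M_nonneg: "0 \<le> M" using c_g_pos T_pos by (simp add: M_def)
  have near: "near_period C k (2 * r1 + 1)" "near_period C k (2 * r2 + 1)"
    and widths: "width_error (2 * r1 + 1) \<le> n / a - width (2 * r1 + 1)"
      "width_error (2 * r1 + 1) + r1 + 1 \<le> width (2 * r1 + 1)"
      "width_error (2 * r2 + 1) \<le> width (2 * r2 + 1) - n / a"
    using inner outer unfolding inner_period_def outer_period_def cube by auto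
  let ?Z = "M * (C * ln k / k\<^sup>2) + 20 * (C * k\<^sup>2 * ln k)"
  have "grid_polygon n f (nat \<lfloor>M\<rfloor>) x
      \<le> f x + (real (nat \<lfloor>M\<rfloor>) / real (2 * r1 + 1) + 20 * width_error (2 * r1 + 1)) / n"
    using grid_polygon_parabola_bounds(1)[OF n_pos a_pos widths] unfolding f_def by blast
  also have "\<dots> \<le> f x + (M / k + ?Z) / n"
    using steps_over_period_bounds(1)[OF M_nonneg refl near(1)]
    by (intro add_left_mono divide_right_mono) auto
  finally have upper: "grid_polygon n f (nat \<lfloor>M\<rfloor>) x \<le> f x + M / k / n + ?Z / n"
    by (simp add: add_divide_distrib)
  have "f x + (M / k - ?Z) / n
      \<le> f x + (real (nat \<lfloor>M\<rfloor>) / real (2 * r2 + 1) - 4 * width_error (2 * r2 + 1)) / n"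
    using steps_over_period_bounds(2)[OF M_nonneg refl near(2)]
    by (intro add_left_mono divide_right_mono) auto
  also have "\<dots> \<le> grid_polygon n f (nat \<lfloor>M\<rfloor>) x"
    using grid_polygon_parabola_bounds(2)[OF n_pos a_pos widths] unfolding f_def by blast
  finally have "f x + M / k / n - ?Z / n \<le> grid_polygon n f (nat \<lfloor>M\<rfloor>) x"
    by (simp add: diff_divide_distrib)
  then show ?thesis using upper by linarith
qed

lemma scaled_error_le:
  fixes a T :: real and n :: nat
  assumes n_pos: "n > 0" and a_pos: "a > 0" and T_pos: "T > 0" and C_nonneg: "0 \<le> C"
    and k_props: "k = c_g * root 3 (real n / a)" "1 \<le> k" "k \<le> (k / c_g) ^ 3"
  defines "M \<equiv> c_g * T * real n powr (4/3)"
  shows "M / k / n = T * a powr (1/3)"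
    and "(M * (C * ln k / k\<^sup>2) + 20 * (C * k\<^sup>2 * ln k)) / n
      \<le> C * (1 / c_g + 20 * c_g\<^sup>2) * (T * a powr (2/3) + a powr (-2/3)) * ln (n / a) / n powr (1/3)"
proof -
  define p where "p = real n powr (1/3)"
  define \<alpha> where "\<alpha> = a powr (1/3)"
  have pos: "0 < p" "0 < \<alpha>" using n_pos a_pos by (auto simp: p_def \<alpha>_def)
  have n_eq: "real n = p ^ 3" using n_pos by (simp add: p_def powr_powr flip: powr_realpow)
  have M_eq: "M = c_g * T * p ^ 4"
    using n_pos by (simp add: M_def p_def powr_powr flip: powr_realpow)
  have \<alpha>2: "a powr (2/3) = \<alpha>\<^sup>2" using a_pos by (simp add: \<alpha>_def powr_powr flip: powr_realpow)
  then have \<alpha>2_inv: "a powr (-2/3) = 1 / \<alpha>\<^sup>2" using a_pos powr_minus_divide[of a "2/3"] by simp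
  have k_eq: "k = c_g * p / \<alpha>"
    using n_pos a_pos by (simp add: k_props(1) p_def \<alpha>_def real_root_divide root_powr_inverse)
  show "M / k / n = T * a powr (1/3)"
    unfolding M_eq n_eq k_eq \<alpha>_def[symmetric] using c_g_pos pos
    by (simp add: field_simps power3_eq_cube power4_eq_xxxx)
  have cube: "(k / c_g) ^ 3 = n / a"
    using k_props(1) n_pos a_pos c_g_pos by (simp add: real_root_pow_pos2)
  have ln_k: "0 \<le> ln k" "ln k \<le> ln (n / a)" using k_props(2,3) unfolding cube by auto
  have "(M * (C * ln k / k\<^sup>2) + 20 * (C * k\<^sup>2 * ln k)) / n
      = C * (T * \<alpha>\<^sup>2 * (1 / c_g) + 1 / \<alpha>\<^sup>2 * (20 * c_g\<^sup>2)) * ln k / p"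
    unfolding M_eq n_eq k_eq using c_g_pos pos
    by (simp add: field_simps power2_eq_square power3_eq_cube power4_eq_xxxx)
  also have "\<dots> \<le> C * ((T * \<alpha>\<^sup>2 + 1 / \<alpha>\<^sup>2) * (1 / c_g + 20 * c_g\<^sup>2)) * ln (n / a) / p"
  proof (intro divide_right_mono mult_mono mult_left_mono)
    have "0 \<le> T * \<alpha>\<^sup>2 * (20 * c_g\<^sup>2)" "0 \<le> 1 / \<alpha>\<^sup>2 * (1 / c_g)" using T_pos c_g_pos by auto
    then show "T * \<alpha>\<^sup>2 * (1 / c_g) + 1 / \<alpha>\<^sup>2 * (20 * c_g\<^sup>2) \<le> (T * \<alpha>\<^sup>2 + 1 / \<alpha>\<^sup>2) * (1 / c_g + 20 * c_g\<^sup>2)"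
      by (simp only: distrib_left distrib_right)
  qed (use C_nonneg T_pos c_g_pos pos ln_k in auto)
  also have "\<dots> = C * (1 / c_g + 20 * c_g\<^sup>2) * (T * \<alpha>\<^sup>2 + 1 / \<alpha>\<^sup>2) * ln (n / a) / p"
    by (simp add: ac_simps)
  finally show "(M * (C * ln k / k\<^sup>2) + 20 * (C * k\<^sup>2 * ln k)) / n
      \<le> C * (1 / c_g + 20 * c_g\<^sup>2) * (T * a powr (2/3) + a powr (-2/3)) * ln (n / a) / n powr (1/3)"
    unfolding \<alpha>2 \<alpha>2_inv p_def .
qed

lemma eventually_grid_polygon_parabola_near:
  defines "C \<equiv> 28 + 192 * c_g ^ 3"
  assumes a_pos: "a > 0" and T_pos: "T > 0"
  shows "\<forall>\<^sub>F n in sequentially. \<forall>x.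
    \<bar>grid_polygon n (\<lambda>x. a / 2 * x\<^sup>2 + b * x + c) (nat \<lfloor>c_g * T * real n powr (4/3)\<rfloor>) x
      - (a / 2 * x\<^sup>2 + b * x + c + T * a powr (1/3))\<bar>
    \<le> C * (1 / c_g + 20 * c_g\<^sup>2) * (T * a powr (2/3) + a powr (-2/3)) * ln (real n / a) / real n powr (1/3)"
proof -
  have C_nonneg: "0 \<le> C" using c_g_pos by (simp add: C_def)
  have "\<forall>\<^sub>F k::real in at_top. 1 \<le> k" "\<forall>\<^sub>F k in at_top. k \<le> (k / c_g) ^ 3"
    using c_g_pos by - real_asymp+
  with eventually_inner_period eventually_outer_period
  have "\<forall>\<^sub>F k in at_top. 1 \<le> k \<and> k \<le> (k / c_g) ^ 3
      \<and> (\<exists>r1 r2. inner_period C k (2 * r1 + 1) \<and> outer_period C k (2 * r2 + 1))"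
    unfolding C_def by eventually_elim blast
  moreover have "filterlim (\<lambda>n. c_g * root 3 (real n / a)) at_top sequentially"
    using c_g_pos a_pos by real_asymp
  ultimately have "\<forall>\<^sub>F n in sequentially. let k = c_g * root 3 (real n / a) in 1 \<le> k \<and> k \<le> (k / c_g) ^ 3
      \<and> (\<exists>r1 r2. inner_period C k (2 * r1 + 1) \<and> outer_period C k (2 * r2 + 1))"
    unfolding Let_def by (rule eventually_compose_filterlim)
  moreover have "\<forall>\<^sub>F n in sequentially. 0 < n" by (rule eventually_gt_at_top)
  ultimately show ?thesis
  proof eventually_elim
    case (elim n)
    define k where "k = c_g * root 3 (real n / a)"
    obtain r1 r2 where k_large: "1 \<le> k" "k \<le> (k / c_g) ^ 3"
      and periods: "inner_period C k (2 * r1 + 1)" "outer_period C k (2 * r2 + 1)"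
      using elim(1) unfolding k_def[symmetric] Let_def by blast
    note speed = scaled_error_le(1)[OF elim(2) a_pos T_pos C_nonneg k_def k_large]
      and error = scaled_error_le(2)[OF elim(2) a_pos T_pos C_nonneg k_def k_large]
    show ?case
      using order_trans[OF grid_polygon_parabola_near[OF elim(2) a_pos T_pos k_def periods, unfolded speed] error]
      by blast
  qed
qed

theorem theorem1:
  "\<exists>C::real. \<forall>(a::real) (b::real) (c::real) (T::real). a > 0 \<longrightarrow> T > 0 \<longrightarrow>
     acsf_graph_flow (\<lambda>t x. a / 2 * x\<^sup>2 + b * x + c + t * a powr (1/3))
                     (\<lambda>x. a / 2 * x\<^sup>2 + b * x + c) \<and>
     (\<exists>N::nat. \<forall>n\<ge>N. \<forall>x::real.
        \<bar>grid_polygon n (\<lambda>x. a / 2 * x\<^sup>2 + b * x + c) (nat \<lfloor>c_g * T * real n powr (4/3)\<rfloor>) x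
          - (a / 2 * x\<^sup>2 + b * x + c + T * a powr (1/3))\<bar>
        \<le> C * (T * a powr (2/3) + a powr (-2/3)) * ln (real n / a) / real n powr (1/3))"
proof (rule exI, intro allI impI conjI)
  fix a b c T :: real assume "0 < a" "0 < T"
  then show "acsf_graph_flow (\<lambda>t x. a / 2 * x\<^sup>2 + b * x + c + t * a powr (1/3)) (\<lambda>x. a / 2 * x\<^sup>2 + b * x + c)"
    by (intro acsf_graph_flow_parabola)
  show "\<exists>N. \<forall>n\<ge>N. \<forall>x.
      \<bar>grid_polygon n (\<lambda>x. a / 2 * x\<^sup>2 + b * x + c) (nat \<lfloor>c_g * T * real n powr (4/3)\<rfloor>) x
        - (a / 2 * x\<^sup>2 + b * x + c + T * a powr (1/3))\<bar>
      \<le> (28 + 192 * c_g ^ 3) * (1 / c_g + 20 * c_g\<^sup>2) * (T * a powr (2/3) + a powr (-2/3))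
          * ln (real n / a) / real n powr (1/3)"
    using eventually_grid_polygon_parabola_near[OF \<open>0 < a\<close> \<open>0 < T\<close>, of b c]
    unfolding eventually_sequentially .
qed

end
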